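(* Let $G$ be a locally compact, compactly generated group. If $G$ admits a Hilbert length function $L$ with growth $L(g)\succ|g|_S^{1/2}$ (in particular, if it admits a Hilbert length function with linear growth), then $G$ is amenable.
   Context: Let $G$ be a locally compact, compactly generated group and $|\cdot|_S$ the word length with respect to a compact symmetric generating subset $S$. A 1-cocycle of $G$ is a continuous map $b:G\to\mathcal{H}$ to a Hilbert space carrying a continuous unitary or orthogonal representation $\pi$ of $G$, with $b(gh)=\pi(g)b(h)+b(g)$ for all $g,h\in G$. A Hilbert length function on $G$ is a function of the form $g\mapsto\|b(g)\|$ with $b$ a 1-cocycle. For $f,h:G\to\mathbf{R}_+$, $f\succ h$ (equivalently $h\prec f$) means that for every $\varepsilon>0$ there is a compact $K\subset G$ with $h\le\varepsilon f$ outside $K$. A Hilbert length function $L$ has linear growth if there are $M>0$ and a compact $K\subset G$ with $|g|_S\le M L(g)$ for all $g\notin K$. *)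

theory Defs
  imports "HOL-Algebra.Generated_Groups" "HOL-Analysis.Analysis"
begin

section \<open>Topological groups\<close>

locale topological_group = group G for G (structure) +
  fixes T :: "'a topology"
  assumes topspace_eq: "topspace T = carrier G"
    and continuous_mult: "continuous_map (prod_topology T T) T (\<lambda>(x, y). x \<otimes> y)"
    and continuous_inv: "continuous_map T T (\<lambda>x. inv x)"

text \<open>Locally compact groups are Hausdorff by convention.\<close>

locale locally_compact_group = topological_group +
  assumes locally_compact: "locally_compact_space T"
    and Hausdorff: "Hausdorff_space T"

definition compact_symmetric_generating_set ::
    "('a, 'm) monoid_scheme \<Rightarrow> 'a topology \<Rightarrow> 'a set \<Rightarrow> bool" where
  "compact_symmetric_generating_set G T S \<longleftrightarrow>
     compactin T S \<and> (\<forall>s\<in>S. inv\<^bsub>G\<^esub> s \<in> S) \<and> generate G S = carrier G"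

definition word_length :: "('a, 'm) monoid_scheme \<Rightarrow> 'a set \<Rightarrow> 'a \<Rightarrow> nat" where
  "word_length G S g =
     (LEAST n. \<exists>ss. length ss = n \<and> set ss \<subseteq> S \<and> foldr (\<otimes>\<^bsub>G\<^esub>) ss \<one>\<^bsub>G\<^esub> = g)"

section \<open>Amenability\<close>

definition bounded_continuous_functions :: "'a topology \<Rightarrow> ('a \<Rightarrow> real) set" where
  "bounded_continuous_functions T =
     {f. continuous_map T euclideanreal f \<and> bounded (f ` topspace T)}"

text \<open>
  A left-invariant mean on the space of bounded continuous real functions on the group. Functions
  are total on the type, but only their values on the carrier matter: by positivity and
  linearity, functions that agree on the carrier have the same mean.
\<close>

definition left_invariant_mean ::
    "('a, 'm) monoid_scheme \<Rightarrow> 'a topology \<Rightarrow> (('a \<Rightarrow> real) \<Rightarrow> real) \<Rightarrow> bool" where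
  "left_invariant_mean G T m \<longleftrightarrow>
     (\<forall>f\<in>bounded_continuous_functions T. \<forall>h\<in>bounded_continuous_functions T.
        m (\<lambda>x. f x + h x) = m f + m h) \<and>
     (\<forall>f\<in>bounded_continuous_functions T. \<forall>c. m (\<lambda>x. c * f x) = c * m f) \<and>
     (\<forall>f\<in>bounded_continuous_functions T. (\<forall>x\<in>carrier G. 0 \<le> f x) \<longrightarrow> 0 \<le> m f) \<and>
     m (\<lambda>x. 1) = 1 \<and>
     (\<forall>f\<in>bounded_continuous_functions T. \<forall>g\<in>carrier G. m (\<lambda>x. f (g \<otimes>\<^bsub>G\<^esub> x)) = m f)"

definition amenable :: "('a, 'm) monoid_scheme \<Rightarrow> 'a topology \<Rightarrow> bool" where
  "amenable G T \<longleftrightarrow> (\<exists>m. left_invariant_mean G T m)"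

section \<open>Complex Hilbert spaces\<close>

text \<open>
  Complex inner product spaces, with the inner product linear in the first argument. The
  underlying real inner product is the real part of the complex one, so the norm and the topology
  are those of the complex inner product. Real Hilbert spaces are the types of sort
  \<open>{real_inner, complete_space}\<close>.
\<close>

class complex_inner = real_inner +
  fixes scaleC :: "complex \<Rightarrow> 'a \<Rightarrow> 'a"
    and cinner :: "'a \<Rightarrow> 'a \<Rightarrow> complex"
  assumes scaleC_add_right: "scaleC c (x + y) = scaleC c x + scaleC c y"
    and scaleC_add_left: "scaleC (c + d) x = scaleC c x + scaleC d x"
    and scaleC_scaleC: "scaleC c (scaleC d x) = scaleC (c * d) x"
    and scaleC_of_real: "scaleC (complex_of_real r) x = scaleR r x"
    and cinner_commute: "cinner x y = cnj (cinner y x)"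
    and cinner_add_left: "cinner (x + y) z = cinner x z + cinner y z"
    and cinner_scaleC_left: "cinner (scaleC c x) y = c * cinner x y"
    and Re_cinner: "Re (cinner x y) = inner x y"

class complex_hilbert_space = complex_inner + complete_space

instantiation complex :: complex_hilbert_space
begin

definition "scaleC c (z::complex) = c * z"

definition "cinner (z::complex) w = z * cnj w"

instance
  by standard
    (simp_all add: scaleC_complex_def cinner_complex_def algebra_simps scaleR_conv_of_real
      inner_complex_def)

end

section \<open>Representations, cocycles and Hilbert length functions\<close>

text \<open>
  Continuity of representations is strong continuity. Surjectivity of the operators follows
  from \<open>\<pi> \<one> = id\<close> and multiplicativity.
\<close>

definition continuous_representation ::
    "('a, 'm) monoid_scheme \<Rightarrow> 'a topology \<Rightarrow> ('a \<Rightarrow> 'h::real_normed_vector \<Rightarrow> 'h) \<Rightarrow> bool" where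
  "continuous_representation G T \<pi> \<longleftrightarrow>
     (\<forall>g\<in>carrier G. linear (\<pi> g)) \<and>
     \<pi> \<one>\<^bsub>G\<^esub> = id \<and>
     (\<forall>g\<in>carrier G. \<forall>h\<in>carrier G. \<pi> (g \<otimes>\<^bsub>G\<^esub> h) = \<pi> g \<circ> \<pi> h) \<and>
     (\<forall>v. continuous_map T euclidean (\<lambda>g. \<pi> g v))"

definition orthogonal_representation ::
    "('a, 'm) monoid_scheme \<Rightarrow> 'a topology \<Rightarrow> ('a \<Rightarrow> 'h::real_inner \<Rightarrow> 'h) \<Rightarrow> bool" where
  "orthogonal_representation G T \<pi> \<longleftrightarrow>
     continuous_representation G T \<pi> \<and> (\<forall>g\<in>carrier G. orthogonal_transformation (\<pi> g))"

definition unitary_representation ::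
    "('a, 'm) monoid_scheme \<Rightarrow> 'a topology \<Rightarrow> ('a \<Rightarrow> 'h::complex_inner \<Rightarrow> 'h) \<Rightarrow> bool" where
  "unitary_representation G T \<pi> \<longleftrightarrow>
     continuous_representation G T \<pi> \<and>
     (\<forall>g\<in>carrier G. \<forall>c v. \<pi> g (scaleC c v) = scaleC c (\<pi> g v)) \<and>
     (\<forall>g\<in>carrier G. \<forall>v w. cinner (\<pi> g v) (\<pi> g w) = cinner v w)"

definition cocycle ::
    "('a, 'm) monoid_scheme \<Rightarrow> 'a topology \<Rightarrow> ('a \<Rightarrow> 'h::real_normed_vector \<Rightarrow> 'h) \<Rightarrow> ('a \<Rightarrow> 'h) \<Rightarrow> bool"
  where
  "cocycle G T \<pi> b \<longleftrightarrow>
     continuous_map T euclidean b \<and>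
     (\<forall>g\<in>carrier G. \<forall>h\<in>carrier G. b (g \<otimes>\<^bsub>G\<^esub> h) = \<pi> g (b h) + b g)"

text \<open>
  The type arguments are the real and the complex Hilbert space in which the cocycle may take
  its values.
\<close>

definition hilbert_length_function ::
    "'h::{real_inner, complete_space} itself \<Rightarrow> 'k::complex_hilbert_space itself \<Rightarrow>
     ('a, 'm) monoid_scheme \<Rightarrow> 'a topology \<Rightarrow> ('a \<Rightarrow> real) \<Rightarrow> bool" where
  "hilbert_length_function _ _ G T L \<longleftrightarrow>
     (\<exists>(\<pi> :: 'a \<Rightarrow> 'h \<Rightarrow> 'h) b. orthogonal_representation G T \<pi> \<and> cocycle G T \<pi> b \<and>
        (\<forall>g\<in>carrier G. L g = norm (b g))) \<or>
     (\<exists>(\<pi> :: 'a \<Rightarrow> 'k \<Rightarrow> 'k) b. unitary_representation G T \<pi> \<and> cocycle G T \<pi> b \<and>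
        (\<forall>g\<in>carrier G. L g = norm (b g)))"

section \<open>Growth\<close>

text \<open>\<open>grows_faster T f h\<close> is the relation $f \succ h$.\<close>

definition grows_faster :: "'a topology \<Rightarrow> ('a \<Rightarrow> real) \<Rightarrow> ('a \<Rightarrow> real) \<Rightarrow> bool" where
  "grows_faster T f h \<longleftrightarrow>
     (\<forall>\<epsilon>>0. \<exists>K. compactin T K \<and> (\<forall>g \<in> topspace T - K. h g \<le> \<epsilon> * f g))"

definition linear_growth ::
    "('a, 'm) monoid_scheme \<Rightarrow> 'a topology \<Rightarrow> 'a set \<Rightarrow> ('a \<Rightarrow> real) \<Rightarrow> bool" where
  "linear_growth G T S L \<longleftrightarrow>
     (\<exists>M>0. \<exists>K. compactin T K \<and>
        (\<forall>g \<in> carrier G - K. real (word_length G S g) \<le> M * L g))"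

end

theory Submission
  imports Defs
begin

text \<open>
  Why slow decay of a random walk forces amenability. Let \<open>b\<close> be a cocycle with
  \<open>\<parallel>b\<parallel>\<^sup>2\<close> growing faster than the word length, and consider the random walk
  \<open>g\<^sub>n\<close> on \<open>G\<close> whose steps are uniform on a finite symmetric set \<open>B\<close>. The cocycle
  identity gives \<open>\<parallel>b(g h)\<parallel> = \<parallel>b(h) - b(g\<^sup>-\<^sup>1)\<parallel>\<close>; for independent
  symmetric \<open>g\<close>, \<open>h\<close> with the same law this yields \<open>E \<parallel>b(g h)\<parallel>\<^sup>2 = 2 E \<parallel>b(g)\<parallel>\<^sup>2 - 2 \<parallel>E b(g)\<parallel>\<^sup>2\<close>,
  so \<open>E \<parallel>b(g\<^sub>n)\<parallel>\<^sup>2 \<le> C n\<close> for \<open>n\<close> a power of two (\<open>walk_mean_energy\<close>).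
  By Markov's inequality and the growth hypothesis, \<open>g\<^sub>n\<close> lies with probability at least
  one half in the union of a fixed compact set and a word ball of radius \<open>\<eta> n\<close>, where \<open>\<eta> > 0\<close>
  is as small as desired. Such a set is covered by at most \<open>M + N\<^sup>\<eta>\<^sup>n\<close> left
  translates of one compact set (\<open>product_power_covering\<close>), since balls grow at most exponentially.

  Now let \<open>P\<close> be the averaging operator of \<open>B\<close> on the space \<open>Cc\<close> of compactly supported
  continuous functions with the \<open>L\<^sup>2\<close> norm of a Haar measure. Concentration on few translates and
  the Cauchy-Schwarz inequality give \<open>\<parallel>P\<^sup>n w\<parallel>\<^sup>2 \<ge> c N\<^sup>-\<^sup>2\<^sup>\<eta>\<^sup>n\<close>
  for a fixed bump function \<open>w\<close> (\<open>walk_return_lower_bound\<close>). If there were no almost invariant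
  vectors for \<open>B\<close>, uniform convexity would make \<open>P\<close> a strict contraction
  (\<open>walk_step_contraction\<close>), so that \<open>\<parallel>P\<^sup>n w\<parallel>\<^sup>2 \<le> \<theta>\<^sup>n \<parallel>w\<parallel>\<^sup>2\<close>
  with \<open>\<theta> < 1\<close> independent of \<open>\<eta>\<close>: a contradiction for small \<open>\<eta>\<close> and large \<open>n\<close>
  (\<open>almost_invariant_vectors\<close>). An almost invariant vector \<open>\<xi>\<close> defines the almost invariant
  mean \<open>f \<mapsto> \<integral>f \<xi>\<^sup>2 / \<integral>\<xi>\<^sup>2\<close> on bounded continuous functions, and an
  ultrafilter limit of such means is an invariant mean.

  The Haar measure enters as an invariant positive linear functional on \<open>Cc\<close>. It is constructed
  by Weil's method, as an ultrafilter limit of normalised covering numbers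
  (\<open>haar_functional_exists\<close>). Only the norm identity for \<open>b\<close> above is used, so real and
  complex Hilbert spaces are treated alike.
\<close>

section \<open>Limits along ultrafilters\<close>

definition ultrafilter :: "'i filter \<Rightarrow> bool" where
  "ultrafilter U \<longleftrightarrow> U \<noteq> bot \<and> (\<forall>P. eventually P U \<or> eventually (\<lambda>i. \<not> P i) U)"

lemma finer_ultrafilter_exists:
  fixes F :: "'i filter"
  assumes "F \<noteq> bot"
  shows "\<exists>U\<le>F. ultrafilter U"
proof -
  define A where "A = {F'. F' \<le> F \<and> F' \<noteq> bot}"
  have "\<exists>m\<in>A. \<forall>a\<in>A. m \<ge> a \<longrightarrow> a = m"
  proof (rule predicate_Zorn)
    show "partial_order_on A (relation_of (\<ge>) A)"
      by (rule partial_order_on_relation_ofI) auto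
  next
    fix C assume "C \<in> Chains (relation_of (\<ge>) A)"
    then have chain: "\<And>a b. a \<in> C \<Longrightarrow> b \<in> C \<Longrightarrow> a \<le> b \<or> b \<le> a" and sub: "\<And>a. a \<in> C \<Longrightarrow> a \<in> A"
      unfolding Chains_def relation_of_def by auto
    show "\<exists>u\<in>A. \<forall>a\<in>C. a \<ge> u"
    proof (cases "C = {}")
      case True
      then show ?thesis using assms by (auto simp: A_def)
    next
      case False
      have ev: "eventually P (Inf C) \<longleftrightarrow> (\<exists>b\<in>C. eventually P b)" for P
        using False
      proof (rule eventually_Inf_base)
        fix F G assume "F \<in> C" "G \<in> C"
        then show "\<exists>x\<in>C. x \<le> inf F G"
          using chain[of F G] by (metis inf.absorb1 inf.absorb2 order_refl)
      qed
      have "Inf C \<noteq> bot"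
        using ev[of "\<lambda>_. False"] sub by (auto simp: trivial_limit_def A_def)
      moreover have "Inf C \<le> F"
        using False sub by (metis (mono_tags, lifting) A_def Inf_lower2 all_not_in_conv mem_Collect_eq)
      ultimately show ?thesis
        by (intro bexI[of _ "Inf C"]) (auto simp: A_def Inf_lower)
    qed
  qed
  then obtain U where U: "U \<in> A" and max: "\<And>a. a \<in> A \<Longrightarrow> a \<le> U \<Longrightarrow> a = U" by auto
  have "eventually P U \<or> eventually (\<lambda>i. \<not> P i) U" for P
  proof (rule disjCI)
    assume n: "\<not> eventually (\<lambda>i. \<not> P i) U"
    have "inf U (principal {i. P i}) \<noteq> bot"
      using n by (simp add: trivial_limit_def eventually_inf_principal)
    then have "inf U (principal {i. P i}) = U"
      using U by (intro max) (auto simp: A_def intro: le_infI1)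
    then show "eventually P U"
      using eventually_inf_principal[of P U "{i. P i}"] by simp
  qed
  with U show ?thesis by (auto simp: ultrafilter_def A_def)
qed

text \<open>
  Bounded real functions live in a compact interval, where an ultrafilter accumulates at a point
  and therefore converges to it. Hence \<open>Lim U\<close> is a linear, monotone choice of limits.
\<close>

lemma ultrafilter_bounded_convergent:
  fixes h :: "'i \<Rightarrow> real"
  assumes "ultrafilter U" and "eventually (\<lambda>i. a \<le> h i \<and> h i \<le> b) U"
  shows "(h \<longlongrightarrow> Lim U h) U"
proof -
  have nb: "filtermap h U \<noteq> bot"
    using assms(1) by (auto simp: ultrafilter_def filtermap_bot_iff)
  have "eventually (\<lambda>x. x \<in> {a..b}) (filtermap h U)"
    using assms(2) by (simp add: eventually_filtermap)
  then obtain l where l: "inf (nhds l) (filtermap h U) \<noteq> bot"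
    using compact_Icc[of a b] nb unfolding compact_filter by blast
  have "(h \<longlongrightarrow> l) U"
  proof (rule topological_tendstoI)
    fix S assume S: "open S" "l \<in> S"
    show "eventually (\<lambda>i. h i \<in> S) U"
    proof (rule ccontr)
      assume "\<not> ?thesis"
      then have "eventually (\<lambda>i. h i \<notin> S) U"
        using assms(1) by (auto simp: ultrafilter_def)
      then have "eventually (\<lambda>x. x \<notin> S) (filtermap h U)"
        by (simp add: eventually_filtermap)
      moreover have "eventually (\<lambda>x. x \<in> S) (nhds l)"
        using S by (rule eventually_nhds_in_open)
      ultimately have "eventually (\<lambda>x. False) (inf (nhds l) (filtermap h U))"
        unfolding eventually_inf by blast
      with l show False by (simp add: trivial_limit_def)
    qed
  qed
  with assms(1) show ?thesis
    by (metis ultrafilter_def tendsto_Lim)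
qed

section \<open>Compactly supported continuous functions\<close>

context locally_compact_group
begin

lemma mult_continuous_map:
  assumes "continuous_map X T f" "continuous_map X T g"
  shows "continuous_map X T (\<lambda>x. f x \<otimes> g x)"
proof -
  have "continuous_map X T ((\<lambda>(x, y). x \<otimes> y) \<circ> (\<lambda>x. (f x, g x)))"
    by (rule continuous_map_compose[OF _ continuous_mult]) (intro continuous_map_pairedI assms)
  then show ?thesis by (simp add: o_def)
qed

lemma left_translation_continuous:
  assumes "g \<in> carrier G"
  shows "continuous_map T T (\<lambda>x. g \<otimes> x)"
  by (intro mult_continuous_map) (use assms in \<open>auto simp: topspace_eq\<close>)

lemma compactin_set_mult:
  assumes "compactin T A" "compactin T B"
  shows "compactin T (A <#> B)"
proof -
  have "A <#> B = (\<lambda>(x, y). x \<otimes> y) ` (A \<times> B)"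
    by (auto simp: set_mult_def)
  then show ?thesis
    using image_compactin[OF _ continuous_mult, of "A \<times> B"] assms
    by (simp add: compactin_Times)
qed

lemma compactin_carrier: "compactin T A \<Longrightarrow> A \<subseteq> carrier G"
  using compactin_subset_topspace topspace_eq by blast

lemma openin_carrier: "openin T A \<Longrightarrow> A \<subseteq> carrier G"
  using openin_subset topspace_eq by blast

lemma completely_regular: "completely_regular_space T"
  using locally_compact_regular_imp_completely_regular_space locally_compact Hausdorff by blast

definition Cc :: "('a \<Rightarrow> real) set" where
  "Cc = {f. continuous_map T euclideanreal f \<and>
            (\<exists>K. compactin T K \<and> (\<forall>x\<in>carrier G - K. f x = 0))}"

lemma CcI:
  "continuous_map T euclideanreal f \<Longrightarrow> compactin T K \<Longrightarrow> (\<And>x. x \<in> carrier G - K \<Longrightarrow> f x = 0) \<Longrightarrow> f \<in> Cc"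
  unfolding Cc_def by blast

lemma CcE:
  assumes "f \<in> Cc"
  obtains K where "compactin T K" "\<And>x. x \<in> carrier G - K \<Longrightarrow> f x = 0"
  using assms unfolding Cc_def by blast

lemma Cc_continuous: "f \<in> Cc \<Longrightarrow> continuous_map T euclideanreal f"
  unfolding Cc_def by blast

lemma Cc_zero: "(\<lambda>x. 0) \<in> Cc"
  by (rule CcI[of _ "{}"]) auto

lemma Cc_mult_continuous:
  assumes "f \<in> Cc" "continuous_map T euclideanreal g"
  shows "(\<lambda>x. g x * f x) \<in> Cc"
proof -
  obtain K where K: "compactin T K" "\<And>x. x \<in> carrier G - K \<Longrightarrow> f x = 0" using CcE[OF assms(1)] by blast
  show ?thesis
    by (rule CcI[OF _ K(1)])
      (use assms K(2) in \<open>simp_all add: continuous_map_real_mult Cc_continuous\<close>)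
qed

lemma Cc_mult: "f \<in> Cc \<Longrightarrow> g \<in> Cc \<Longrightarrow> (\<lambda>x. f x * g x) \<in> Cc"
  using Cc_mult_continuous Cc_continuous by blast

lemma Cc_scale: "f \<in> Cc \<Longrightarrow> (\<lambda>x. c * f x) \<in> Cc"
  using Cc_mult_continuous[of f "\<lambda>x. c"] by simp

lemma Cc_power2: "f \<in> Cc \<Longrightarrow> (\<lambda>x. (f x)\<^sup>2) \<in> Cc"
  using Cc_mult[of f f] by (simp add: power2_eq_square)

lemma Cc_add:
  assumes "f \<in> Cc" "g \<in> Cc"
  shows "(\<lambda>x. f x + g x) \<in> Cc"
proof -
  obtain K where K: "compactin T K" "\<And>x. x \<in> carrier G - K \<Longrightarrow> f x = 0" using CcE[OF assms(1)] by blast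
  obtain L where L: "compactin T L" "\<And>x. x \<in> carrier G - L \<Longrightarrow> g x = 0" using CcE[OF assms(2)] by blast
  show ?thesis
    by (rule CcI[of _ "K \<union> L"])
      (use assms K L in \<open>simp_all add: continuous_map_add Cc_continuous compactin_Un\<close>)
qed

lemma Cc_minus: "f \<in> Cc \<Longrightarrow> (\<lambda>x. - f x) \<in> Cc"
  using Cc_scale[of f "-1"] by simp

lemma Cc_diff: "f \<in> Cc \<Longrightarrow> g \<in> Cc \<Longrightarrow> (\<lambda>x. f x - g x) \<in> Cc"
  using Cc_add[OF _ Cc_minus] by fastforce

lemma Cc_sum: "finite A \<Longrightarrow> (\<And>i. i \<in> A \<Longrightarrow> f i \<in> Cc) \<Longrightarrow> (\<lambda>x. \<Sum>i\<in>A. f i x) \<in> Cc"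
  by (induction rule: finite_induct) (auto intro: Cc_add Cc_zero)

lemma Cc_positive_part:
  assumes "f \<in> Cc"
  shows "(\<lambda>x. max (f x) 0) \<in> Cc"
proof -
  obtain K where K: "compactin T K" "\<And>x. x \<in> carrier G - K \<Longrightarrow> f x = 0" using CcE[OF assms(1)] by blast
  show ?thesis
    by (rule CcI[OF _ K(1)])
      (use assms K(2) in \<open>simp_all add: continuous_map_real_max Cc_continuous\<close>)
qed

lemma Cc_translate:
  assumes "f \<in> Cc" "g \<in> carrier G"
  shows "(\<lambda>x. f (g \<otimes> x)) \<in> Cc"
proof -
  obtain K where K: "compactin T K" "\<And>x. x \<in> carrier G - K \<Longrightarrow> f x = 0" using CcE[OF assms(1)] by blast
  show ?thesis
  proof (rule CcI)
    show "continuous_map T euclideanreal (\<lambda>x. f (g \<otimes> x))"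
      using continuous_map_compose[OF left_translation_continuous[OF assms(2)] Cc_continuous[OF assms(1)]]
      by (simp add: o_def)
    show "compactin T ((\<lambda>x. inv g \<otimes> x) ` K)"
      using K(1) by (rule image_compactin) (simp add: left_translation_continuous assms)
    show "f (g \<otimes> x) = 0" if "x \<in> carrier G - (\<lambda>x. inv g \<otimes> x) ` K" for x
    proof (rule K(2))
      have "x = inv g \<otimes> (g \<otimes> x)" using that assms by (simp add: m_assoc[symmetric])
      then show "g \<otimes> x \<in> carrier G - K" using that assms by auto
    qed
  qed
qed

lemma Cc_bounded:
  assumes "f \<in> Cc"
  obtains M where "M > 0" "\<And>x. x \<in> carrier G \<Longrightarrow> \<bar>f x\<bar> \<le> M"
proof -
  obtain K where K: "compactin T K" "\<And>x. x \<in> carrier G - K \<Longrightarrow> f x = 0" using CcE[OF assms(1)] by blast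
  have "compactin euclideanreal (f ` K)"
    using K(1) Cc_continuous[OF assms] by (rule image_compactin)
  then have "bounded (f ` K)" by (simp add: compact_imp_bounded)
  then obtain M where "M > 0" "\<And>x. x \<in> K \<Longrightarrow> \<bar>f x\<bar> \<le> M"
    by (metis bounded_pos imageI real_norm_def)
  then show ?thesis using K(2) that[of M] by (metis DiffI abs_zero less_eq_real_def)
qed

lemma Cc_bump:
  assumes "compactin T K" "openin T W" "K \<subseteq> W"
  obtains f where "f \<in> Cc" "\<forall>x\<in>carrier G. 0 \<le> f x \<and> f x \<le> 1"
    "\<forall>x\<in>K. f x = 1" "\<forall>x\<in>carrier G - W. f x = 0"
proof -
  obtain U L where UL: "openin T U" "compactin T L" "K \<subseteq> U" "U \<subseteq> L"
    using assms(1) locally_compact locally_compact_space_compact_closed_compact[of T] Hausdorff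
    by blast
  have "closedin T (topspace T - (U \<inter> W))"
    using UL(1) assms(2) by (intro closedin_diff openin_Int) auto
  moreover have "disjnt K (topspace T - (U \<inter> W))"
    using assms(3) UL(3) by (auto simp: disjnt_def)
  ultimately obtain f where f: "continuous_map T (top_of_set {0..1::real}) f"
      "f ` (topspace T - (U \<inter> W)) \<subseteq> {0}" "f ` K \<subseteq> {1}"
    by (rule Urysohn_completely_regular_compact_closed[OF zero_le_one completely_regular assms(1)])
  show thesis
  proof (rule that)
    show "f \<in> Cc"
      by (rule CcI[OF _ UL(2)])
        (use f UL in \<open>auto simp: continuous_map_in_subtopology topspace_eq image_subset_iff\<close>)
    show "\<forall>x\<in>carrier G. 0 \<le> f x \<and> f x \<le> 1"
      using continuous_map_funspace[OF f(1)] by (auto simp: topspace_eq Pi_iff)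
  qed (use f in \<open>auto simp: topspace_eq\<close>)
qed

text \<open>
  Right translation by elements near \<open>\<one>\<close> moves \<open>h\<close> little, uniformly: near the compact
  support this is the tube lemma, and a point outside the support that is moved into it is handled
  by moving it back, which is why the neighbourhood is taken symmetric.
\<close>

lemma Cc_uniformly_continuous:
  assumes "h \<in> Cc" "\<delta> > 0"
  obtains V where "openin T V" "\<one> \<in> V"
    "\<And>x v. x \<in> carrier G \<Longrightarrow> v \<in> V \<Longrightarrow> \<bar>h (x \<otimes> v) - h x\<bar> < \<delta>"
proof -
  obtain K where K: "compactin T K" "\<And>x. x \<in> carrier G - K \<Longrightarrow> h x = 0" using CcE[OF assms(1)] by blast
  define q where "q = (\<lambda>p. \<bar>h (snd p \<otimes> fst p) - h (snd p)\<bar>)"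
  have cfst: "continuous_map (prod_topology T T) T fst" and csnd: "continuous_map (prod_topology T T) T snd"
    by (rule continuous_map_fst, rule continuous_map_snd)
  have "continuous_map (prod_topology T T) euclideanreal q"
    unfolding q_def
    using continuous_map_compose[OF mult_continuous_map[OF csnd cfst] Cc_continuous[OF assms(1)]]
      continuous_map_compose[OF csnd Cc_continuous[OF assms(1)]]
    by (simp add: o_def continuous_map_real_abs continuous_map_diff)
  then have W: "openin (prod_topology T T) {p \<in> topspace (prod_topology T T). q p \<in> {..<\<delta>}}"
    by (rule openin_continuous_map_preimage) auto
  have sub: "{\<one>} \<times> K \<subseteq> {p \<in> topspace (prod_topology T T). q p \<in> {..<\<delta>}}"
    using compactin_carrier[OF K(1)] assms(2) by (auto simp: q_def topspace_eq subset_iff)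
  have "\<one> \<in> topspace T" by (simp add: topspace_eq)
  from tube_lemma_right[OF W K(1) this sub] obtain U V where UV:
      "openin T U" "openin T V" "\<one> \<in> U" "K \<subseteq> V"
      "U \<times> V \<subseteq> {p \<in> topspace (prod_topology T T). q p \<in> {..<\<delta>}}"
    by blast
  have near: "\<bar>h (x \<otimes> v) - h x\<bar> < \<delta>" if "x \<in> K" "v \<in> U" for x v
  proof -
    have "(v, x) \<in> U \<times> V" using UV(4) that by auto
    then show ?thesis using UV(5) by (auto simp: q_def)
  qed
  define V' where "V' = U \<inter> {x \<in> topspace T. inv x \<in> U}"
  have V': "openin T V'"
    unfolding V'_def using UV(1) by (intro openin_Int openin_continuous_map_preimage[OF continuous_inv])
  show thesis
  proof (rule that[OF V'])
    show "\<one> \<in> V'" using UV(3) by (simp add: V'_def topspace_eq)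
    fix x v assume x: "x \<in> carrier G" and v: "v \<in> V'"
    have vG: "v \<in> carrier G" using v by (simp add: V'_def topspace_eq)
    consider "x \<in> K" | "x \<notin> K" "x \<otimes> v \<in> K" | "x \<notin> K" "x \<otimes> v \<notin> K" by blast
    then show "\<bar>h (x \<otimes> v) - h x\<bar> < \<delta>"
    proof cases
      case 1 then show ?thesis using near v by (simp add: V'_def)
    next
      case 2
      have "\<bar>h (x \<otimes> v \<otimes> inv v) - h (x \<otimes> v)\<bar> < \<delta>"
        using 2 v by (intro near) (auto simp: V'_def)
      then show ?thesis using x vG by (simp add: m_assoc abs_minus_commute)
    next
      case 3 then show ?thesis using K(2) x vG assms(2) by simp
    qed
  qed
qed

end

section \<open>Covering numbers\<close>

context locally_compact_group
begin

lemma compact_covered_by_translates: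
  assumes K: "compactin T K" and V: "openin T V" "v \<in> V"
  obtains A where "finite A" "A \<subseteq> carrier G" "\<forall>x\<in>K. \<exists>a\<in>A. a \<otimes> x \<in> V"
proof -
  have KG: "K \<subseteq> carrier G" and vG: "v \<in> carrier G"
    using compactin_carrier[OF K] openin_carrier[OF V(1)] V(2) by auto
  define W where "W = (\<lambda>a. {x \<in> topspace T. a \<otimes> x \<in> V})"
  have op: "openin T (W a)" if "a \<in> carrier G" for a
    unfolding W_def by (rule openin_continuous_map_preimage[OF left_translation_continuous[OF that] V(1)])
  have sub: "K \<subseteq> \<Union> (W ` carrier G)"
  proof
    fix k assume "k \<in> K"
    then have kG: "k \<in> carrier G" using KG by auto
    show "k \<in> \<Union> (W ` carrier G)"
    proof (rule UN_I)
      show "v \<otimes> inv k \<in> carrier G" using vG kG by simp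
      show "k \<in> W (v \<otimes> inv k)" using vG V(2) kG by (simp add: W_def topspace_eq m_assoc)
    qed
  qed
  have "\<exists>\<F>. finite \<F> \<and> \<F> \<subseteq> W ` carrier G \<and> K \<subseteq> \<Union> \<F>"
    by (rule K[unfolded compactin_def, THEN conjunct2, rule_format]) (use sub op in auto)
  then obtain \<F> where \<F>: "finite \<F>" "\<F> \<subseteq> W ` carrier G" "K \<subseteq> \<Union> \<F>" by blast
  obtain A where "A \<subseteq> carrier G" "finite A" "\<F> = W ` A"
    using finite_subset_image[OF \<F>(1,2)] by blast
  with \<F>(3) have "finite A" "A \<subseteq> carrier G" "K \<subseteq> \<Union> (W ` A)" by auto
  then show thesis by (intro that[of A]) (auto simp: W_def)
qed

definition translate_sum :: "('a \<Rightarrow> real) \<Rightarrow> (real \<times> 'a) list \<Rightarrow> 'a \<Rightarrow> real" where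
  "translate_sum \<phi> xs x = (\<Sum>(c, a)\<leftarrow>xs. c * \<phi> (a \<otimes> x))"

definition covers :: "('a \<Rightarrow> real) \<Rightarrow> ('a \<Rightarrow> real) \<Rightarrow> (real \<times> 'a) list \<Rightarrow> bool" where
  "covers \<phi> f xs \<longleftrightarrow> (\<forall>(c, a)\<in>set xs. 0 \<le> c \<and> a \<in> carrier G) \<and>
     (\<forall>x\<in>carrier G. f x \<le> translate_sum \<phi> xs x)"

text \<open>
  Weil's covering number \<open>(f : \<phi>)\<close>: the least total weight of a finite combination of left
  translates of \<open>\<phi>\<close> that dominates \<open>f\<close>. It approximates the ratio of the Haar integrals of
  \<open>f\<close> and \<open>\<phi>\<close>, the better the smaller the support of \<open>\<phi>\<close>. For signed \<open>f\<close> it is the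
  covering number of the positive part.
\<close>

definition covering_number :: "('a \<Rightarrow> real) \<Rightarrow> ('a \<Rightarrow> real) \<Rightarrow> real" where
  "covering_number \<phi> f = Inf {sum_list (map fst xs) |xs. covers \<phi> f xs}"

text \<open>
  The bound by 1 ensures that covering numbers dominate the values of the covered function; in
  particular the number by which ratios are normalised is positive.
\<close>

definition gauge_function :: "('a \<Rightarrow> real) \<Rightarrow> bool" where
  "gauge_function \<phi> \<longleftrightarrow> \<phi> \<in> Cc \<and> (\<forall>x\<in>carrier G. 0 \<le> \<phi> x \<and> \<phi> x \<le> 1) \<and> (\<exists>x\<in>carrier G. 0 < \<phi> x)"

lemma translate_sum_simps [simp]:
  "translate_sum \<phi> [] x = 0"
  "translate_sum \<phi> (p # xs) x = fst p * \<phi> (snd p \<otimes> x) + translate_sum \<phi> xs x"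
  "translate_sum \<phi> (xs @ ys) x = translate_sum \<phi> xs x + translate_sum \<phi> ys x"
  by (auto simp: translate_sum_def case_prod_beta)

lemma covers_sum_nonneg: "covers \<phi> f xs \<Longrightarrow> 0 \<le> sum_list (map fst xs)"
  by (rule sum_list_nonneg) (auto simp: covers_def case_prod_beta)

lemma covering_number_le:
  assumes "covers \<phi> f xs"
  shows "covering_number \<phi> f \<le> sum_list (map fst xs)"
  unfolding covering_number_def
  by (rule cInf_lower) (use assms covers_sum_nonneg in \<open>auto intro!: bdd_belowI[of _ 0]\<close>)

lemma covers_exists:
  assumes "gauge_function \<phi>" "f \<in> Cc"
  shows "\<exists>xs. covers \<phi> f xs"
proof -
  obtain v where v: "v \<in> carrier G" "0 < \<phi> v" and \<phi>: "\<phi> \<in> Cc" "\<And>x. x \<in> carrier G \<Longrightarrow> 0 \<le> \<phi> x"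
    using assms(1) by (auto simp: gauge_function_def)
  obtain M where M: "M > 0" "\<And>x. x \<in> carrier G \<Longrightarrow> \<bar>f x\<bar> \<le> M" using Cc_bounded[OF assms(2)] by blast
  obtain K where K: "compactin T K" "\<And>x. x \<in> carrier G - K \<Longrightarrow> f x = 0" using CcE[OF assms(2)] by blast
  define r where "r = \<phi> v / 2"
  have r: "0 < r" "r < \<phi> v" using v by (auto simp: r_def)
  have op: "openin T {x \<in> topspace T. \<phi> x \<in> {r<..}}"
    by (rule openin_continuous_map_preimage[OF Cc_continuous[OF \<phi>(1)]]) auto
  have "v \<in> {x \<in> topspace T. \<phi> x \<in> {r<..}}" using v r by (simp add: topspace_eq)
  from compact_covered_by_translates[OF K(1) op this] obtain A where A: "finite A" "A \<subseteq> carrier G"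
      "\<forall>x\<in>K. \<exists>a\<in>A. a \<otimes> x \<in> {x \<in> topspace T. \<phi> x \<in> {r<..}}"
    by blast
  obtain as where as: "set as = A" using A(1) finite_list by auto
  define xs where "xs = map (\<lambda>a. (M / r, a)) as"
  have ts: "translate_sum \<phi> xs x = (\<Sum>a\<leftarrow>as. M / r * \<phi> (a \<otimes> x))" for x
    by (simp add: translate_sum_def xs_def o_def)
  have nonneg: "0 \<le> t" if "t \<in> set (map (\<lambda>a. M / r * \<phi> (a \<otimes> x)) as)" "x \<in> carrier G" for t x
    using that \<phi>(2) A(2) as M r by auto
  have "f x \<le> translate_sum \<phi> xs x" if x: "x \<in> carrier G" for x
  proof (cases "x \<in> K")
    case False
    then show ?thesis using K(2) x nonneg by (auto simp: ts intro!: sum_list_nonneg)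
  next
    case True
    then obtain a where a: "a \<in> A" "r < \<phi> (a \<otimes> x)" using A(3) by auto
    have "f x \<le> M" using M(2)[OF x] by auto
    also have "M \<le> M / r * \<phi> (a \<otimes> x)" using a(2) r M(1) by (simp add: field_simps)
    also have "\<dots> \<le> translate_sum \<phi> xs x"
      unfolding ts by (rule member_le_sum_list) (use a as nonneg x in auto)
    finally show ?thesis .
  qed
  moreover have "\<forall>(c, a)\<in>set xs. 0 \<le> c \<and> a \<in> carrier G"
    using A(2) as M(1) r(1) by (auto simp: xs_def)
  ultimately show ?thesis by (auto simp: covers_def)
qed

lemma covering_number_greatest:
  assumes "gauge_function \<phi>" "f \<in> Cc" "\<And>xs. covers \<phi> f xs \<Longrightarrow> r \<le> sum_list (map fst xs)"
  shows "r \<le> covering_number \<phi> f"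
  unfolding covering_number_def
  by (rule cInf_greatest) (use assms(3) covers_exists[OF assms(1,2)] in auto)

lemma covering_number_nonneg: "gauge_function \<phi> \<Longrightarrow> f \<in> Cc \<Longrightarrow> 0 \<le> covering_number \<phi> f"
  by (rule covering_number_greatest) (simp_all add: covers_sum_nonneg)

lemma covering_number_add:
  assumes "gauge_function \<phi>" "f \<in> Cc" "g \<in> Cc"
  shows "covering_number \<phi> (\<lambda>x. f x + g x) \<le> covering_number \<phi> f + covering_number \<phi> g"
proof -
  have "covering_number \<phi> (\<lambda>x. f x + g x) - covering_number \<phi> g \<le> covering_number \<phi> f"
  proof (rule covering_number_greatest[OF assms(1,2)])
    fix xs assume xs: "covers \<phi> f xs"
    have "covering_number \<phi> (\<lambda>x. f x + g x) - sum_list (map fst xs) \<le> covering_number \<phi> g"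
    proof (rule covering_number_greatest[OF assms(1,3)])
      fix ys assume ys: "covers \<phi> g ys"
      have "covers \<phi> (\<lambda>x. f x + g x) (xs @ ys)"
        using xs ys unfolding covers_def by (auto intro: add_mono)
      from covering_number_le[OF this]
      show "covering_number \<phi> (\<lambda>x. f x + g x) - sum_list (map fst xs) \<le> sum_list (map fst ys)"
        by simp
    qed
    then show "covering_number \<phi> (\<lambda>x. f x + g x) - covering_number \<phi> g \<le> sum_list (map fst xs)"
      by simp
  qed
  then show ?thesis by simp
qed

lemma translate_sum_scale: "translate_sum \<phi> (map (\<lambda>(d, a). (c * d, a)) xs) x = c * translate_sum \<phi> xs x"
  by (induction xs) (auto simp: algebra_simps)

lemma covering_number_scale:
  assumes "gauge_function \<phi>" "f \<in> Cc" "0 \<le> c"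
  shows "covering_number \<phi> (\<lambda>x. c * f x) \<le> c * covering_number \<phi> f"
proof (cases "c = 0")
  case True
  have "covers \<phi> (\<lambda>x. c * f x) []" using True by (auto simp: covers_def)
  from covering_number_le[OF this] True show ?thesis by simp
next
  case False
  with assms have c: "c > 0" by simp
  have "covering_number \<phi> (\<lambda>x. c * f x) / c \<le> covering_number \<phi> f"
  proof (rule covering_number_greatest[OF assms(1,2)])
    fix xs assume xs: "covers \<phi> f xs"
    let ?ys = "map (\<lambda>(d, a). (c * d, a)) xs"
    have "covers \<phi> (\<lambda>x. c * f x) ?ys"
      using xs c unfolding covers_def translate_sum_scale by fastforce
    from covering_number_le[OF this]
    have "covering_number \<phi> (\<lambda>x. c * f x) \<le> sum_list (map fst ?ys)" .
    also have "map fst ?ys = map (\<lambda>p. c * fst p) xs" by auto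
    also have "sum_list \<dots> = c * sum_list (map fst xs)" by (simp add: sum_list_const_mult)
    finally show "covering_number \<phi> (\<lambda>x. c * f x) / c \<le> sum_list (map fst xs)"
      using c by (simp add: field_simps)
  qed
  then show ?thesis using c by (simp add: field_simps)
qed

lemma covering_number_mono:
  assumes "gauge_function \<phi>" "g \<in> Cc" "\<And>x. x \<in> carrier G \<Longrightarrow> f x \<le> g x"
  shows "covering_number \<phi> f \<le> covering_number \<phi> g"
proof (rule covering_number_greatest[OF assms(1,2)])
  fix xs assume "covers \<phi> g xs"
  then have "covers \<phi> f xs" using assms(3) unfolding covers_def by (meson order_trans)
  then show "covering_number \<phi> f \<le> sum_list (map fst xs)" by (rule covering_number_le)
qed

lemma covering_number_translate:
  assumes "gauge_function \<phi>" "f \<in> Cc" "g \<in> carrier G"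
  shows "covering_number \<phi> (\<lambda>x. f (g \<otimes> x)) \<le> covering_number \<phi> f"
proof (rule covering_number_greatest[OF assms(1,2)])
  fix xs assume xs: "covers \<phi> f xs"
  let ?ys = "map (\<lambda>(c, a). (c, a \<otimes> g)) xs"
  have inG: "\<forall>p\<in>set xs. 0 \<le> fst p \<and> snd p \<in> carrier G" using xs by (auto simp: covers_def)
  have ts: "translate_sum \<phi> ?ys x = translate_sum \<phi> xs (g \<otimes> x)" if "x \<in> carrier G" for x
    using inG that assms(3) by (induction xs) (auto simp: m_assoc)
  have "covers \<phi> (\<lambda>x. f (g \<otimes> x)) ?ys"
    using xs inG assms(3) unfolding covers_def by (auto simp: ts)
  from covering_number_le[OF this] show "covering_number \<phi> (\<lambda>x. f (g \<otimes> x)) \<le> sum_list (map fst xs)"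
    by (simp add: o_def case_prod_beta)
qed

lemma covering_number_ge_value:
  assumes "gauge_function \<phi>" "f \<in> Cc" "x \<in> carrier G"
  shows "f x \<le> covering_number \<phi> f"
proof (rule covering_number_greatest[OF assms(1,2)])
  fix xs assume xs: "covers \<phi> f xs"
  have inG: "\<forall>p\<in>set xs. 0 \<le> fst p \<and> snd p \<in> carrier G" using xs by (auto simp: covers_def)
  have "f x \<le> translate_sum \<phi> xs x" using xs assms(3) by (auto simp: covers_def)
  also have "translate_sum \<phi> xs x \<le> sum_list (map fst xs)"
    using inG
  proof (induction xs)
    case (Cons p xs)
    have "\<phi> (snd p \<otimes> x) \<le> 1" using Cons.prems assms(1,3) by (auto simp: gauge_function_def)
    then have "fst p * \<phi> (snd p \<otimes> x) \<le> fst p" using Cons.prems by (simp add: mult_left_le)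
    then show ?case using Cons by (simp add: add_mono)
  qed simp
  finally show "f x \<le> sum_list (map fst xs)" .
qed

lemma translate_sum_Cc:
  assumes "f \<in> Cc" "\<forall>p\<in>set xs. snd p \<in> carrier G"
  shows "translate_sum f xs \<in> Cc"
proof -
  have "(\<lambda>x. translate_sum f xs x) \<in> Cc"
    using assms(2)
  proof (induction xs)
    case (Cons p xs)
    then show ?case
      unfolding translate_sum_simps by (intro Cc_add Cc_scale Cc_translate assms(1)) auto
  next
    case Nil
    have "translate_sum f [] = (\<lambda>x. 0)" by (rule ext) simp
    then show ?case by (simp add: Cc_zero)
  qed
  then show ?thesis by simp
qed

text \<open>
  Covering \<open>f\<close> by translates of \<open>h\<close>, and these by translates of \<open>\<phi>\<close>. Consequently the ratios
  \<open>(f : \<phi>) / (h : \<phi>)\<close> are bounded uniformly in \<open>\<phi>\<close>, so that they have limits.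
\<close>

lemma covering_number_trans:
  assumes \<phi>: "gauge_function \<phi>" and h: "gauge_function h" and f: "f \<in> Cc"
  shows "covering_number \<phi> f \<le> covering_number h f * covering_number \<phi> h"
proof -
  have hC: "h \<in> Cc" using h by (simp add: gauge_function_def)
  obtain v where "v \<in> carrier G" "0 < h v" using h by (auto simp: gauge_function_def)
  then have pos: "0 < covering_number \<phi> h"
    using covering_number_ge_value[OF \<phi> hC] by fastforce
  have "covering_number \<phi> f / covering_number \<phi> h \<le> covering_number h f"
  proof (rule covering_number_greatest[OF h f])
    fix xs assume xs: "covers h f xs"
    have inG: "\<forall>p\<in>set xs. 0 \<le> fst p \<and> snd p \<in> carrier G" using xs by (auto simp: covers_def)
    have "covering_number \<phi> f \<le> covering_number \<phi> (translate_sum h xs)"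
      using xs by (intro covering_number_mono[OF \<phi> translate_sum_Cc[OF hC]]) (auto simp: covers_def)
    also have "covering_number \<phi> (translate_sum h xs) \<le> sum_list (map fst xs) * covering_number \<phi> h"
      using inG
    proof (induction xs)
      case Nil
      have "covers \<phi> (translate_sum h []) []" by (auto simp: covers_def)
      from covering_number_le[OF this] show ?case by (simp del: translate_sum_simps)
    next
      case (Cons p xs)
      have eq: "translate_sum h (p # xs) = (\<lambda>x. fst p * h (snd p \<otimes> x) + translate_sum h xs x)"
        by (rule ext) simp
      have tC: "(\<lambda>x. h (snd p \<otimes> x)) \<in> Cc" using Cons.prems by (intro Cc_translate hC) auto
      have "covering_number \<phi> (translate_sum h (p # xs)) \<le>
          covering_number \<phi> (\<lambda>x. fst p * h (snd p \<otimes> x)) + covering_number \<phi> (translate_sum h xs)"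
        unfolding eq using Cons.prems
        by (intro covering_number_add[OF \<phi>] Cc_scale tC translate_sum_Cc hC) auto
      also have "covering_number \<phi> (\<lambda>x. fst p * h (snd p \<otimes> x)) \<le> fst p * covering_number \<phi> (\<lambda>x. h (snd p \<otimes> x))"
        using Cons.prems by (intro covering_number_scale[OF \<phi> tC]) auto
      also have "\<dots> \<le> fst p * covering_number \<phi> h"
        using Cons.prems by (intro mult_left_mono covering_number_translate[OF \<phi> hC]) auto
      finally have "covering_number \<phi> (translate_sum h (p # xs)) \<le>
          fst p * covering_number \<phi> h + covering_number \<phi> (translate_sum h xs)" by simp
      also have "\<dots> \<le> fst p * covering_number \<phi> h + sum_list (map fst xs) * covering_number \<phi> h"
        using Cons by simp
      finally show ?case by (simp add: distrib_right del: translate_sum_simps)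
    qed
    finally show "covering_number \<phi> f / covering_number \<phi> h \<le> sum_list (map fst xs)"
      using pos by (simp add: field_simps)
  qed
  then show ?thesis using pos by (simp add: field_simps)
qed

text \<open>
  Covering numbers are only subadditive, but become additive in the limit of small supports. Given
  a cover of \<open>F = f1 + f2 + \<delta> f'\<close>, multiply the weight of each translate by the value of
  \<open>h\<^sub>i = f\<^sub>i / F\<close>, up to \<open>\<delta>\<close>, at the place where that translate is concentrated. By uniform
  continuity of \<open>h\<^sub>i\<close> this covers \<open>f\<^sub>i\<close>, and \<open>h\<^sub>1 + h\<^sub>2 \<le> 1\<close> bounds the total weight.
\<close>

lemma covering_number_almost_superadditive:
  assumes f: "f1 \<in> Cc" "f2 \<in> Cc" "\<And>x. x \<in> carrier G \<Longrightarrow> 0 \<le> f1 x" "\<And>x. x \<in> carrier G \<Longrightarrow> 0 \<le> f2 x"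
    and f': "f' \<in> Cc" "\<And>x. x \<in> carrier G \<Longrightarrow> 0 \<le> f' x"
      "\<And>x. x \<in> carrier G \<Longrightarrow> f1 x \<noteq> 0 \<or> f2 x \<noteq> 0 \<Longrightarrow> f' x = 1"
    and \<delta>: "0 < \<delta>"
  obtains V where "openin T V" "\<one> \<in> V"
    "\<forall>\<phi>. gauge_function \<phi> \<longrightarrow> (\<forall>x\<in>carrier G - V. \<phi> x = 0) \<longrightarrow>
       covering_number \<phi> f1 + covering_number \<phi> f2 \<le>
       (1 + 2 * \<delta>) * (covering_number \<phi> (\<lambda>x. f1 x + f2 x) + \<delta> * covering_number \<phi> f')"
proof -
  define F where "F x = f1 x + f2 x + \<delta> * f' x" for x
  \<comment> \<open>\<open>F\<close> vanishes far away, so the quotients are formed with \<open>D\<close>, which agrees with \<open>F\<close>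
      wherever \<open>f1\<close> or \<open>f2\<close> is nonzero and is bounded below by \<open>\<delta>\<close>.\<close>
  define D where "D x = f1 x + f2 x + \<delta>" for x
  define h1 where "h1 = (\<lambda>x. inverse (D x) * f1 x)"
  define h2 where "h2 = (\<lambda>x. inverse (D x) * f2 x)"
  have Dpos: "0 < D x" if "x \<in> carrier G" for x using f(3,4)[OF that] \<delta> by (simp add: D_def)
  have "continuous_map T euclideanreal D"
    unfolding D_def using f(1,2) by (intro continuous_map_add) (auto intro: Cc_continuous)
  then have cD: "continuous_map T euclideanreal (\<lambda>x. inverse (D x))"
    by (rule continuous_map_real_inverse) (use Dpos in \<open>force simp: topspace_eq\<close>)
  have hC: "h1 \<in> Cc" "h2 \<in> Cc"
    unfolding h1_def h2_def by (intro Cc_mult_continuous[OF _ cD] f)+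
  have FC: "F \<in> Cc"
    using Cc_add[OF Cc_add[OF f(1,2)] Cc_scale[OF f'(1), of \<delta>]] by (simp add: F_def[abs_def])
  have F0: "0 \<le> F x" if "x \<in> carrier G" for x
    using f(3,4)[OF that] f'(2)[OF that] \<delta> by (simp add: F_def)
  have f1F: "f1 x = F x * h1 x" and f2F: "f2 x = F x * h2 x"
    and h0: "0 \<le> h1 x" "0 \<le> h2 x" and hsum: "h1 x + h2 x \<le> 1" if x: "x \<in> carrier G" for x
  proof -
    have "F x = D x" if "f1 x \<noteq> 0 \<or> f2 x \<noteq> 0" using f'(3)[OF x that] by (simp add: F_def D_def)
    then show "f1 x = F x * h1 x" "f2 x = F x * h2 x"
      using Dpos[OF x] unfolding h1_def h2_def by (cases "f1 x = 0"; cases "f2 x = 0"; simp)+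
    show "0 \<le> h1 x" "0 \<le> h2 x" using Dpos[OF x] f(3,4)[OF x] by (auto simp: h1_def h2_def)
    have "h1 x + h2 x = (f1 x + f2 x) / D x" by (simp add: h1_def h2_def divide_inverse algebra_simps)
    also have "\<dots> \<le> 1" using Dpos[OF x] \<delta> by (simp add: D_def)
    finally show "h1 x + h2 x \<le> 1" .
  qed
  obtain V1 where V1: "openin T V1" "\<one> \<in> V1"
      "\<And>x v. x \<in> carrier G \<Longrightarrow> v \<in> V1 \<Longrightarrow> \<bar>h1 (x \<otimes> v) - h1 x\<bar> < \<delta>"
    using Cc_uniformly_continuous[OF hC(1) \<delta>] by blast
  obtain V2 where V2: "openin T V2" "\<one> \<in> V2"
      "\<And>x v. x \<in> carrier G \<Longrightarrow> v \<in> V2 \<Longrightarrow> \<bar>h2 (x \<otimes> v) - h2 x\<bar> < \<delta>"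
    using Cc_uniformly_continuous[OF hC(2) \<delta>] by blast
  show thesis
  proof (rule that)
    show "openin T (V1 \<inter> V2)" "\<one> \<in> V1 \<inter> V2" using V1 V2 by auto
    show "\<forall>\<phi>. gauge_function \<phi> \<longrightarrow> (\<forall>x\<in>carrier G - (V1 \<inter> V2). \<phi> x = 0) \<longrightarrow>
       covering_number \<phi> f1 + covering_number \<phi> f2 \<le>
       (1 + 2 * \<delta>) * (covering_number \<phi> (\<lambda>x. f1 x + f2 x) + \<delta> * covering_number \<phi> f')"
    proof (intro allI impI)
      fix \<phi> assume \<phi>: "gauge_function \<phi>" and supp: "\<forall>x\<in>carrier G - (V1 \<inter> V2). \<phi> x = 0"
      have \<phi>0: "0 \<le> \<phi> x" if "x \<in> carrier G" for x using \<phi> that by (auto simp: gauge_function_def)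
      have key: "covering_number \<phi> (\<lambda>x. F x * h x) \<le> (\<Sum>(c, a)\<leftarrow>xs. c * (h (inv a) + \<delta>))"
        if xs: "covers \<phi> F xs" and h: "\<And>x. x \<in> carrier G \<Longrightarrow> 0 \<le> h x"
          "\<And>x v. x \<in> carrier G \<Longrightarrow> v \<in> V1 \<inter> V2 \<Longrightarrow> \<bar>h (x \<otimes> v) - h x\<bar> < \<delta>" for xs h
      proof -
        have inG: "\<forall>p\<in>set xs. 0 \<le> fst p \<and> snd p \<in> carrier G" using xs by (auto simp: covers_def)
        let ?ys = "map (\<lambda>(c, a). (c * (h (inv a) + \<delta>), a)) xs"
        have "F x * h x \<le> translate_sum \<phi> ?ys x" if x: "x \<in> carrier G" for x
        proof -
          have "F x * h x \<le> translate_sum \<phi> xs x * h x"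
            using xs x h(1) by (intro mult_right_mono) (auto simp: covers_def)
          also have "\<dots> \<le> translate_sum \<phi> ?ys x"
            using inG
          proof (induction xs)
            case (Cons p xs)
            obtain c a where p: "p = (c, a)" by (cases p)
            have ca: "0 \<le> c" "a \<in> carrier G" using Cons.prems p by auto
            have "\<phi> (a \<otimes> x) * h x \<le> \<phi> (a \<otimes> x) * (h (inv a) + \<delta>)"
            proof (cases "a \<otimes> x \<in> V1 \<inter> V2")
              case True
              have "\<bar>h (inv a \<otimes> (a \<otimes> x)) - h (inv a)\<bar> < \<delta>" using ca True by (intro h(2)) auto
              then have "h x \<le> h (inv a) + \<delta>" using ca x by (simp add: m_assoc[symmetric])
              then show ?thesis using \<phi>0 ca x by (intro mult_left_mono) auto
            next
              case False
              then have "\<phi> (a \<otimes> x) = 0" using ca x supp by auto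
              then show ?thesis by simp
            qed
            then have "c * (\<phi> (a \<otimes> x) * h x) \<le> c * (\<phi> (a \<otimes> x) * (h (inv a) + \<delta>))"
              by (rule mult_left_mono[OF _ ca(1)])
            then show ?case using Cons p by (simp add: algebra_simps)
          qed simp
          finally show ?thesis .
        qed
        then have "covers \<phi> (\<lambda>x. F x * h x) ?ys"
          using inG h(1) \<delta> unfolding covers_def by (auto intro!: mult_nonneg_nonneg add_nonneg_nonneg)
        from covering_number_le[OF this] show ?thesis by (simp add: o_def case_prod_unfold)
      qed
      have cong: "covering_number \<phi> f1 \<le> covering_number \<phi> (\<lambda>x. F x * h1 x)"
          "covering_number \<phi> f2 \<le> covering_number \<phi> (\<lambda>x. F x * h2 x)"
        using f1F f2F by (intro covering_number_mono[OF \<phi>] Cc_mult hC FC; simp)+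
      have "(covering_number \<phi> f1 + covering_number \<phi> f2) / (1 + 2 * \<delta>) \<le> covering_number \<phi> F"
      proof (rule covering_number_greatest[OF \<phi> FC])
        fix xs assume xs: "covers \<phi> F xs"
        have inG: "\<forall>p\<in>set xs. 0 \<le> fst p \<and> snd p \<in> carrier G" using xs by (auto simp: covers_def)
        have "covering_number \<phi> f1 + covering_number \<phi> f2 \<le>
            (\<Sum>(c, a)\<leftarrow>xs. c * (h1 (inv a) + \<delta>)) + (\<Sum>(c, a)\<leftarrow>xs. c * (h2 (inv a) + \<delta>))"
        proof (rule add_mono)
          show "covering_number \<phi> f1 \<le> (\<Sum>(c, a)\<leftarrow>xs. c * (h1 (inv a) + \<delta>))"
            using V1(3) by (intro order_trans[OF cong(1)] key[OF xs] h0) auto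
          show "covering_number \<phi> f2 \<le> (\<Sum>(c, a)\<leftarrow>xs. c * (h2 (inv a) + \<delta>))"
            using V2(3) by (intro order_trans[OF cong(2)] key[OF xs] h0) auto
        qed
        also have "\<dots> \<le> (1 + 2 * \<delta>) * sum_list (map fst xs)"
          using inG
        proof (induction xs)
          case (Cons p xs)
          obtain c a where p: "p = (c, a)" by (cases p)
          have "c * (h1 (inv a) + h2 (inv a)) \<le> c * 1"
            using Cons.prems p hsum[of "inv a"] by (intro mult_left_mono) auto
          then show ?case using Cons p by (simp add: algebra_simps)
        qed simp
        finally show "(covering_number \<phi> f1 + covering_number \<phi> f2) / (1 + 2 * \<delta>) \<le> sum_list (map fst xs)"
          using \<delta> by (simp add: field_simps)
      qed
      then have "covering_number \<phi> f1 + covering_number \<phi> f2 \<le> (1 + 2 * \<delta>) * covering_number \<phi> F"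
        using \<delta> by (simp add: field_simps)
      also have "covering_number \<phi> F \<le> covering_number \<phi> (\<lambda>x. f1 x + f2 x) + covering_number \<phi> (\<lambda>x. \<delta> * f' x)"
        unfolding F_def by (intro covering_number_add[OF \<phi>] Cc_add Cc_scale f f')
      also have "covering_number \<phi> (\<lambda>x. \<delta> * f' x) \<le> \<delta> * covering_number \<phi> f'"
        using \<delta> by (intro covering_number_scale[OF \<phi> f'(1)]) auto
      finally show "covering_number \<phi> f1 + covering_number \<phi> f2 \<le>
         (1 + 2 * \<delta>) * (covering_number \<phi> (\<lambda>x. f1 x + f2 x) + \<delta> * covering_number \<phi> f')"
        using \<delta> by (simp add: mult_left_mono)
    qed
  qed
qed

end

section \<open>The Haar functional\<close>

context locally_compact_group
begin

definition haar_functional :: "(('a \<Rightarrow> real) \<Rightarrow> real) \<Rightarrow> bool" where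
  "haar_functional I \<longleftrightarrow>
     (\<forall>f\<in>Cc. \<forall>h\<in>Cc. I (\<lambda>x. f x + h x) = I f + I h) \<and>
     (\<forall>f\<in>Cc. \<forall>c. I (\<lambda>x. c * f x) = c * I f) \<and>
     (\<forall>f\<in>Cc. (\<forall>x\<in>carrier G. 0 \<le> f x) \<longrightarrow> 0 \<le> I f) \<and>
     (\<forall>f\<in>Cc. \<forall>g\<in>carrier G. I (\<lambda>x. f (g \<otimes> x)) = I f)"

text \<open>
  The filter of functions \<open>\<phi>\<close> whose support shrinks to the unit.
\<close>

definition gauges_near_one :: "('a \<Rightarrow> real) filter" where
  "gauges_near_one = (INF V\<in>{V. openin T V \<and> \<one> \<in> V}.
     principal {\<phi>. gauge_function \<phi> \<and> (\<forall>x\<in>carrier G - V. \<phi> x = 0)})"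

lemma eventually_gauges_near_one:
  "eventually P gauges_near_one \<longleftrightarrow> (\<exists>V. openin T V \<and> \<one> \<in> V \<and>
     (\<forall>\<phi>. gauge_function \<phi> \<longrightarrow> (\<forall>x\<in>carrier G - V. \<phi> x = 0) \<longrightarrow> P \<phi>))"
proof -
  have "openin T (carrier G)" using openin_topspace[of T] by (simp add: topspace_eq)
  then have ne: "{V. openin T V \<and> \<one> \<in> V} \<noteq> {}" by auto
  show ?thesis
    unfolding gauges_near_one_def
  proof (subst eventually_INF_base[OF ne])
    fix V W assume "V \<in> {V. openin T V \<and> \<one> \<in> V}" "W \<in> {V. openin T V \<and> \<one> \<in> V}"
    then show "\<exists>U\<in>{V. openin T V \<and> \<one> \<in> V}.
        principal {\<phi>. gauge_function \<phi> \<and> (\<forall>x\<in>carrier G - U. \<phi> x = 0)}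
        \<le> inf (principal {\<phi>. gauge_function \<phi> \<and> (\<forall>x\<in>carrier G - V. \<phi> x = 0)})
            (principal {\<phi>. gauge_function \<phi> \<and> (\<forall>x\<in>carrier G - W. \<phi> x = 0)})"
      by (intro bexI[of _ "V \<inter> W"]) auto
  qed (auto simp: eventually_principal)
qed

lemma gauges_near_one_nontrivial: "gauges_near_one \<noteq> bot"
proof
  assume "gauges_near_one = bot"
  then have "eventually (\<lambda>_. False) gauges_near_one" by simp
  then obtain V where V: "openin T V" "\<one> \<in> V"
    and no: "\<forall>\<phi>. gauge_function \<phi> \<longrightarrow> \<not> (\<forall>x\<in>carrier G - V. \<phi> x = 0)"
    unfolding eventually_gauges_near_one by auto
  have "compactin T {\<one>}" by (simp add: compactin_sing topspace_eq)
  then obtain f where f: "f \<in> Cc" "\<forall>x\<in>carrier G. 0 \<le> f x \<and> f x \<le> 1"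
      "\<forall>x\<in>{\<one>}. f x = 1" "\<forall>x\<in>carrier G - V. f x = 0"
    by (rule Cc_bump[OF _ V(1)]) (use V(2) in auto)
  have "gauge_function f"
    unfolding gauge_function_def using f(1-3) by (auto intro!: bexI[of _ \<one>])
  with no f(4) show False by blast
qed

text \<open>
  The limit of \<open>(f : \<phi>) / (h : \<phi>)\<close> as \<open>\<phi>\<close> shrinks to the unit. Subadditivity, monotonicity and
  invariance pass to the limit; additivity on nonnegative functions is the limit of
  \<open>covering_number_almost_superadditive\<close>, first in \<open>\<phi>\<close> and then in \<open>\<delta>\<close>.
\<close>

lemma haar_functional_on_cone:
  assumes h: "gauge_function h"
  obtains J where
    "\<And>f g. f \<in> Cc \<Longrightarrow> g \<in> Cc \<Longrightarrow> (\<And>x. x \<in> carrier G \<Longrightarrow> 0 \<le> f x) \<Longrightarrow> (\<And>x. x \<in> carrier G \<Longrightarrow> 0 \<le> g x) \<Longrightarrow>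
       J (\<lambda>x. f x + g x) = J f + J g"
    "\<And>f c. f \<in> Cc \<Longrightarrow> 0 < c \<Longrightarrow> J (\<lambda>x. c * f x) = c * J f"
    "\<And>f g. f \<in> Cc \<Longrightarrow> g \<in> Cc \<Longrightarrow> (\<And>x. x \<in> carrier G \<Longrightarrow> f x \<le> g x) \<Longrightarrow> J f \<le> J g"
    "\<And>f g. f \<in> Cc \<Longrightarrow> g \<in> carrier G \<Longrightarrow> J (\<lambda>x. f (g \<otimes> x)) = J f"
    "J h = 1"
proof -
  obtain U where U: "U \<le> gauges_near_one" "ultrafilter U"
    using finer_ultrafilter_exists[OF gauges_near_one_nontrivial] by blast
  have Unb: "U \<noteq> bot" using U(2) by (simp add: ultrafilter_def)
  define q where "q \<phi> f = covering_number \<phi> f / covering_number \<phi> h" for \<phi> f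
  define J where "J f = Lim U (\<lambda>\<phi>. q \<phi> f)" for f
  have hC: "h \<in> Cc" using h by (simp add: gauge_function_def)
  obtain v where v: "v \<in> carrier G" "0 < h v" using h by (auto simp: gauge_function_def)
  have pos: "0 < covering_number \<phi> h" if "gauge_function \<phi>" for \<phi>
    using covering_number_ge_value[OF that hC v(1)] v(2) by simp
  have "eventually gauge_function gauges_near_one"
    unfolding eventually_gauges_near_one using openin_topspace[of T] by (auto simp: topspace_eq)
  then have evg: "eventually gauge_function U" using U(1) by (simp add: filter_leD)
  have lim: "((\<lambda>\<phi>. q \<phi> f) \<longlongrightarrow> J f) U" if f: "f \<in> Cc" for f
    unfolding J_def
  proof (rule ultrafilter_bounded_convergent[OF U(2)])
    show "eventually (\<lambda>\<phi>. 0 \<le> q \<phi> f \<and> q \<phi> f \<le> covering_number h f) U"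
      using evg
    proof eventually_elim
      case (elim \<phi>)
      then show ?case
        using covering_number_nonneg[OF elim f] covering_number_trans[OF elim h f] pos[OF elim]
        by (simp add: q_def field_simps)
    qed
  qed
  have mono: "J f \<le> J g" if "f \<in> Cc" "g \<in> Cc" "\<And>x. x \<in> carrier G \<Longrightarrow> f x \<le> g x" for f g
  proof (rule tendsto_le[OF Unb lim[OF that(2)] lim[OF that(1)]])
    show "eventually (\<lambda>\<phi>. q \<phi> f \<le> q \<phi> g) U"
      using evg
    proof eventually_elim
      case (elim \<phi>)
      show ?case
        using covering_number_mono[OF elim that(2,3)] pos[OF elim] by (simp add: q_def divide_right_mono)
    qed
  qed
  have scale: "J (\<lambda>x. c * f x) \<le> c * J f" if "f \<in> Cc" "0 \<le> c" for f c
  proof (rule tendsto_le[OF Unb tendsto_mult_left[OF lim[OF that(1)]] lim[OF Cc_scale[OF that(1)]]])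
    show "eventually (\<lambda>\<phi>. q \<phi> (\<lambda>x. c * f x) \<le> c * q \<phi> f) U"
      using evg
    proof eventually_elim
      case (elim \<phi>)
      show ?case
        using covering_number_scale[OF elim that] pos[OF elim] by (simp add: q_def divide_right_mono)
    qed
  qed
  have trans: "J (\<lambda>x. f (g \<otimes> x)) \<le> J f" if "f \<in> Cc" "g \<in> carrier G" for f g
  proof (rule tendsto_le[OF Unb lim[OF that(1)] lim[OF Cc_translate[OF that]]])
    show "eventually (\<lambda>\<phi>. q \<phi> (\<lambda>x. f (g \<otimes> x)) \<le> q \<phi> f) U"
      using evg
    proof eventually_elim
      case (elim \<phi>)
      show ?case
        using covering_number_translate[OF elim that] pos[OF elim] by (simp add: q_def divide_right_mono)
    qed
  qed
  have subadd: "J (\<lambda>x. f x + g x) \<le> J f + J g" if "f \<in> Cc" "g \<in> Cc" for f g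
  proof (rule tendsto_le[OF Unb tendsto_add[OF lim[OF that(1)] lim[OF that(2)]] lim[OF Cc_add[OF that]]])
    show "eventually (\<lambda>\<phi>. q \<phi> (\<lambda>x. f x + g x) \<le> q \<phi> f + q \<phi> g) U"
      using evg
    proof eventually_elim
      case (elim \<phi>)
      show ?case
        using covering_number_add[OF elim that] pos[OF elim]
        by (simp add: q_def divide_right_mono flip: add_divide_distrib)
    qed
  qed
  have superadd: "J f + J g \<le> J (\<lambda>x. f x + g x)"
    if f: "f \<in> Cc" "g \<in> Cc" "\<And>x. x \<in> carrier G \<Longrightarrow> 0 \<le> f x" "\<And>x. x \<in> carrier G \<Longrightarrow> 0 \<le> g x" for f g
  proof -
    obtain K where K: "compactin T K" "\<And>x. x \<in> carrier G - K \<Longrightarrow> f x = 0" using CcE[OF f(1)] by blast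
    obtain L where L: "compactin T L" "\<And>x. x \<in> carrier G - L \<Longrightarrow> g x = 0" using CcE[OF f(2)] by blast
    have KL: "compactin T (K \<union> L)" using K L by (simp add: compactin_Un)
    obtain f' where f': "f' \<in> Cc" "\<forall>x\<in>carrier G. 0 \<le> f' x \<and> f' x \<le> 1" "\<forall>x\<in>K \<union> L. f' x = 1"
      by (rule Cc_bump[OF KL openin_topspace compactin_subset_topspace[OF KL]])
    have f'1: "f' x = 1" if "x \<in> carrier G" "f x \<noteq> 0 \<or> g x \<noteq> 0" for x
      using f'(3) K(2)[of x] L(2)[of x] that by blast
    have est: "J f + J g \<le> (1 + 2 * \<delta>) * (J (\<lambda>x. f x + g x) + \<delta> * J f')" if \<delta>: "0 < \<delta>" for \<delta>
    proof (rule tendsto_le[OF Unb])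
      show "((\<lambda>\<phi>. q \<phi> f + q \<phi> g) \<longlongrightarrow> J f + J g) U"
        by (intro tendsto_intros lim f)
      show "((\<lambda>\<phi>. (1 + 2 * \<delta>) * (q \<phi> (\<lambda>x. f x + g x) + \<delta> * q \<phi> f')) \<longlongrightarrow>
          (1 + 2 * \<delta>) * (J (\<lambda>x. f x + g x) + \<delta> * J f')) U"
        by (intro tendsto_intros lim f f' Cc_add)
      obtain V where V: "openin T V" "\<one> \<in> V"
        "\<forall>\<phi>. gauge_function \<phi> \<longrightarrow> (\<forall>x\<in>carrier G - V. \<phi> x = 0) \<longrightarrow>
          covering_number \<phi> f + covering_number \<phi> g \<le>
          (1 + 2 * \<delta>) * (covering_number \<phi> (\<lambda>x. f x + g x) + \<delta> * covering_number \<phi> f')"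
        by (rule covering_number_almost_superadditive[OF f f'(1) _ f'1 \<delta>]) (use f'(2) in auto)
      have "eventually (\<lambda>\<phi>. covering_number \<phi> f + covering_number \<phi> g \<le>
          (1 + 2 * \<delta>) * (covering_number \<phi> (\<lambda>x. f x + g x) + \<delta> * covering_number \<phi> f')) gauges_near_one"
        unfolding eventually_gauges_near_one using V by blast
      then have "eventually (\<lambda>\<phi>. covering_number \<phi> f + covering_number \<phi> g \<le>
          (1 + 2 * \<delta>) * (covering_number \<phi> (\<lambda>x. f x + g x) + \<delta> * covering_number \<phi> f')) U"
        using U(1) by (simp add: filter_leD)
      with evg show "eventually (\<lambda>\<phi>. q \<phi> f + q \<phi> g \<le>
          (1 + 2 * \<delta>) * (q \<phi> (\<lambda>x. f x + g x) + \<delta> * q \<phi> f')) U"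
      proof eventually_elim
        case (elim \<phi>)
        have "(covering_number \<phi> f + covering_number \<phi> g) / covering_number \<phi> h \<le>
            (1 + 2 * \<delta>) * (covering_number \<phi> (\<lambda>x. f x + g x) + \<delta> * covering_number \<phi> f') / covering_number \<phi> h"
          using elim(2) pos[OF elim(1)] by (simp add: divide_right_mono)
        also have "\<dots> = (1 + 2 * \<delta>) * (q \<phi> (\<lambda>x. f x + g x) + \<delta> * q \<phi> f')"
          by (simp add: q_def add_divide_distrib ring_distribs)
        finally show ?case by (simp add: q_def add_divide_distrib)
      qed
    qed
    have "((\<lambda>\<delta>. (1 + 2 * \<delta>) * (J (\<lambda>x. f x + g x) + \<delta> * J f')) \<longlongrightarrow>
        (1 + 2 * 0) * (J (\<lambda>x. f x + g x) + 0 * J f')) (at_right 0)"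
      by (intro tendsto_intros)
    moreover have "eventually (\<lambda>\<delta>. J f + J g \<le> (1 + 2 * \<delta>) * (J (\<lambda>x. f x + g x) + \<delta> * J f')) (at_right 0)"
      using eventually_at_right_less[of 0] by eventually_elim (rule est)
    ultimately have "J f + J g \<le> (1 + 2 * 0) * (J (\<lambda>x. f x + g x) + 0 * J f')"
      by (rule tendsto_lowerbound) simp
    then show ?thesis by simp
  qed
  show thesis
  proof (rule that[of J])
    show "J (\<lambda>x. f x + g x) = J f + J g" if "f \<in> Cc" "g \<in> Cc"
      "\<And>x. x \<in> carrier G \<Longrightarrow> 0 \<le> f x" "\<And>x. x \<in> carrier G \<Longrightarrow> 0 \<le> g x" for f g
      by (rule antisym[OF subadd superadd]) (use that in auto)
    show "J (\<lambda>x. c * f x) = c * J f" if "f \<in> Cc" "0 < c" for f c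
    proof (rule antisym)
      show "J (\<lambda>x. c * f x) \<le> c * J f" using that by (intro scale) auto
      have "J (\<lambda>x. inverse c * (c * f x)) \<le> inverse c * J (\<lambda>x. c * f x)"
        using that by (intro scale Cc_scale) auto
      then show "c * J f \<le> J (\<lambda>x. c * f x)"
        using that(2) by (simp add: field_simps)
    qed
    show "J f \<le> J g" if "f \<in> Cc" "g \<in> Cc" "\<And>x. x \<in> carrier G \<Longrightarrow> f x \<le> g x" for f g
      using mono that by blast
    show "J (\<lambda>x. f (g \<otimes> x)) = J f" if fg: "f \<in> Cc" "g \<in> carrier G" for f g
    proof (rule antisym)
      show "J (\<lambda>x. f (g \<otimes> x)) \<le> J f" using trans fg by blast
      have C: "(\<lambda>x. f (g \<otimes> x)) \<in> Cc" using fg by (rule Cc_translate)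
      have "J f \<le> J (\<lambda>x. f (g \<otimes> (inv g \<otimes> x)))"
        using fg by (intro mono Cc_translate[OF C]) (auto simp: m_assoc[symmetric])
      also have "\<dots> \<le> J (\<lambda>x. f (g \<otimes> x))"
        using trans[OF C] fg by simp
      finally show "J f \<le> J (\<lambda>x. f (g \<otimes> x))" .
    qed
    have "eventually (\<lambda>\<phi>. q \<phi> h = 1) U"
      using evg
    proof eventually_elim
      case (elim \<phi>)
      then show ?case using pos[OF elim] by (simp add: q_def)
    qed
    then have "((\<lambda>\<phi>. q \<phi> h) \<longlongrightarrow> 1) U" by (rule tendsto_eventually)
    with lim[OF hC] show "J h = 1" using Unb tendsto_unique by blast
  qed
qed

text \<open>
  The limit on nonnegative functions extends linearly by splitting a function into its positive and
  negative parts. The normalisation \<open>I h = 1\<close> makes the functional nonzero.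
\<close>

theorem haar_functional_exists:
  assumes h: "gauge_function h"
  obtains I where "haar_functional I" "I h = 1"
proof -
  obtain J where
    add: "\<And>f g. f \<in> Cc \<Longrightarrow> g \<in> Cc \<Longrightarrow> (\<And>x. x \<in> carrier G \<Longrightarrow> 0 \<le> f x) \<Longrightarrow> (\<And>x. x \<in> carrier G \<Longrightarrow> 0 \<le> g x) \<Longrightarrow>
       J (\<lambda>x. f x + g x) = J f + J g"
    and scale: "\<And>f c. f \<in> Cc \<Longrightarrow> 0 < c \<Longrightarrow> J (\<lambda>x. c * f x) = c * J f"
    and mono: "\<And>f g. f \<in> Cc \<Longrightarrow> g \<in> Cc \<Longrightarrow> (\<And>x. x \<in> carrier G \<Longrightarrow> f x \<le> g x) \<Longrightarrow> J f \<le> J g"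
    and trans: "\<And>f g. f \<in> Cc \<Longrightarrow> g \<in> carrier G \<Longrightarrow> J (\<lambda>x. f (g \<otimes> x)) = J f"
    and one: "J h = 1"
    using haar_functional_on_cone[OF h] by blast
  define pp where "pp f = (\<lambda>x. max (f x) 0)" for f :: "'a \<Rightarrow> real"
  define I where "I f = J (pp f) - J (pp (\<lambda>x. - f x))" for f
  have ppC: "pp f \<in> Cc" if "f \<in> Cc" for f using Cc_positive_part[OF that] by (simp add: pp_def)
  have pp0: "0 \<le> pp f x" for f x by (simp add: pp_def)
  have J0: "J (\<lambda>x. 0) = 0" using scale[OF Cc_zero, of 2] by simp
  have Jcong: "J f = J g" if "f \<in> Cc" "g \<in> Cc" "\<And>x. x \<in> carrier G \<Longrightarrow> f x = g x" for f g
    by (rule antisym; rule mono) (use that in auto)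
  have add3: "J (\<lambda>x. a x + b x + c x) = J a + J b + J c"
    if "a \<in> Cc" "b \<in> Cc" "c \<in> Cc" "\<And>x. 0 \<le> a x" "\<And>x. 0 \<le> b x" "\<And>x. 0 \<le> c x" for a b c
    using add[of "\<lambda>x. a x + b x" c] add[of a b] that by (simp add: Cc_add)
  have "I (\<lambda>x. f x + g x) = I f + I g" if fg: "f \<in> Cc" "g \<in> Cc" for f g
  proof -
    have C: "pp (\<lambda>x. f x + g x) \<in> Cc" "pp (\<lambda>x. - (f x + g x)) \<in> Cc" "pp f \<in> Cc" "pp g \<in> Cc"
      "pp (\<lambda>x. - f x) \<in> Cc" "pp (\<lambda>x. - g x) \<in> Cc"
      using fg by (intro ppC Cc_add Cc_minus; simp)+
    have "(\<lambda>x. pp (\<lambda>x. f x + g x) x + pp (\<lambda>x. - f x) x + pp (\<lambda>x. - g x) x) =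
      (\<lambda>x. pp (\<lambda>x. - (f x + g x)) x + pp f x + pp g x)"
      by (rule ext) (auto simp: pp_def max_def)
    then have "J (pp (\<lambda>x. f x + g x)) + J (pp (\<lambda>x. - f x)) + J (pp (\<lambda>x. - g x)) =
      J (pp (\<lambda>x. - (f x + g x))) + J (pp f) + J (pp g)"
      using add3[OF C(1,5,6) pp0 pp0 pp0] add3[OF C(2,3,4) pp0 pp0 pp0] by simp
    then show ?thesis by (simp add: I_def)
  qed
  moreover have "I (\<lambda>x. c * f x) = c * I f" if f: "f \<in> Cc" for f c
  proof -
    have C: "pp f \<in> Cc" "pp (\<lambda>x. - f x) \<in> Cc" using f by (auto intro: ppC Cc_minus)
    consider "c = 0" | "c > 0" | "c < 0" by linarith
    then show ?thesis
    proof cases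
      case 1 then show ?thesis by (simp add: I_def)
    next
      case 2
      have "pp (\<lambda>x. c * f x) = (\<lambda>x. c * pp f x)" "pp (\<lambda>x. - (c * f x)) = (\<lambda>x. c * pp (\<lambda>x. - f x) x)"
        using 2 by (auto simp: pp_def fun_eq_iff max_mult_distrib_left)
      then show ?thesis using scale[OF C(1) 2] scale[OF C(2) 2] by (simp add: I_def algebra_simps)
    next
      case 3
      have "pp (\<lambda>x. c * f x) = (\<lambda>x. (- c) * pp (\<lambda>x. - f x) x)" "pp (\<lambda>x. - (c * f x)) = (\<lambda>x. (- c) * pp f x)"
        using 3 by (auto simp: pp_def fun_eq_iff max_def mult_le_0_iff zero_le_mult_iff)
      then show ?thesis using scale[OF C(1), of "- c"] scale[OF C(2), of "- c"] 3
        by (simp add: I_def algebra_simps)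
    qed
  qed
  moreover have Ipos: "I f = J f" if f: "f \<in> Cc" "\<forall>x\<in>carrier G. 0 \<le> f x" for f
  proof -
    have "J (pp f) = J f" "J (pp (\<lambda>x. - f x)) = J (\<lambda>x. 0)"
      using f by (intro Jcong ppC Cc_minus Cc_zero; simp add: pp_def)+
    then show ?thesis by (simp add: I_def J0)
  qed
  moreover have "0 \<le> I f" if f: "f \<in> Cc" "\<forall>x\<in>carrier G. 0 \<le> f x" for f
    using mono[OF Cc_zero f(1)] f(2) Ipos[OF f] by (simp add: J0)
  moreover have "I (\<lambda>x. f (g \<otimes> x)) = I f" if "f \<in> Cc" "g \<in> carrier G" for f g
    using trans[OF ppC[OF that(1)] that(2)] trans[OF ppC[OF Cc_minus[OF that(1)]] that(2)]
    by (simp add: I_def pp_def)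
  ultimately have "haar_functional I" by (simp add: haar_functional_def)
  moreover have "I h = 1" using h one Ipos by (auto simp: gauge_function_def)
  ultimately show thesis by (rule that)
qed

end

section \<open>The Hilbert space seminorm of the Haar functional\<close>

text \<open>
  The Cauchy-Schwarz inequality with a quantitative defect, which comes from
  \<open>2 (n \<Sum> a\<^sub>i\<^sup>2 - (\<Sum> a\<^sub>i)\<^sup>2) = \<Sum>\<^sub>i \<Sum>\<^sub>j (a\<^sub>i - a\<^sub>j)\<^sup>2\<close> by keeping one term.
\<close>

lemma sum_power2_le_card_sum_power2_minus:
  fixes a :: "'i \<Rightarrow> real"
  assumes "finite B" "s \<in> B" "t \<in> B"
  shows "(\<Sum>i\<in>B. a i)\<^sup>2 \<le> card B * (\<Sum>i\<in>B. (a i)\<^sup>2) - (a s - a t)\<^sup>2 / 2"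
proof -
  have p: "(\<Sum>i\<in>B. \<Sum>j\<in>B. a i * a j) = (\<Sum>i\<in>B. a i)\<^sup>2"
    by (simp add: power2_eq_square sum_product)
  have "(\<Sum>i\<in>B. \<Sum>j\<in>B. (a i - a j)\<^sup>2) =
      (\<Sum>i\<in>B. \<Sum>j\<in>B. (a i)\<^sup>2) + (\<Sum>i\<in>B. \<Sum>j\<in>B. (a j)\<^sup>2) - 2 * (\<Sum>i\<in>B. \<Sum>j\<in>B. a i * a j)"
    by (simp add: power2_diff sum.distrib sum_subtractf sum_distrib_left mult.assoc)
  also have "\<dots> = 2 * (card B * (\<Sum>i\<in>B. (a i)\<^sup>2)) - 2 * (\<Sum>i\<in>B. a i)\<^sup>2"
    using p by (simp add: sum_distrib_left)
  finally have eq: "(\<Sum>i\<in>B. \<Sum>j\<in>B. (a i - a j)\<^sup>2) =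
      2 * (card B * (\<Sum>i\<in>B. (a i)\<^sup>2)) - 2 * (\<Sum>i\<in>B. a i)\<^sup>2" .
  have "(a s - a t)\<^sup>2 \<le> (\<Sum>j\<in>B. (a s - a j)\<^sup>2)"
    using assms by (intro member_le_sum[of t B "\<lambda>j. (a s - a j)\<^sup>2"]) auto
  also have "\<dots> \<le> (\<Sum>i\<in>B. \<Sum>j\<in>B. (a i - a j)\<^sup>2)"
    using assms by (intro member_le_sum[of s B "\<lambda>i. \<Sum>j\<in>B. (a i - a j)\<^sup>2"]) (auto intro: sum_nonneg)
  finally show ?thesis unfolding eq by simp
qed

context locally_compact_group
begin

context
  fixes I assumes I: "haar_functional I"
begin

lemma haar_add: "f \<in> Cc \<Longrightarrow> h \<in> Cc \<Longrightarrow> I (\<lambda>x. f x + h x) = I f + I h"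
  and haar_scale: "f \<in> Cc \<Longrightarrow> I (\<lambda>x. c * f x) = c * I f"
  and haar_nonneg: "f \<in> Cc \<Longrightarrow> (\<And>x. x \<in> carrier G \<Longrightarrow> 0 \<le> f x) \<Longrightarrow> 0 \<le> I f"
  and haar_translate: "f \<in> Cc \<Longrightarrow> g \<in> carrier G \<Longrightarrow> I (\<lambda>x. f (g \<otimes> x)) = I f"
  using I by (simp_all add: haar_functional_def)

lemma haar_diff: "f \<in> Cc \<Longrightarrow> h \<in> Cc \<Longrightarrow> I (\<lambda>x. f x - h x) = I f - I h"
  using haar_add[of f "\<lambda>x. - 1 * h x"] haar_scale[of h "- 1"] Cc_minus[of h] by simp

lemma haar_mono:
  assumes "f \<in> Cc" "h \<in> Cc" "\<And>x. x \<in> carrier G \<Longrightarrow> f x \<le> h x"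
  shows "I f \<le> I h"
  using haar_nonneg[OF Cc_diff[OF assms(2,1)]] haar_diff[OF assms(2,1)] assms(3) by simp

lemma haar_cong:
  assumes "f \<in> Cc" "h \<in> Cc" "\<And>x. x \<in> carrier G \<Longrightarrow> f x = h x"
  shows "I f = I h"
  by (rule antisym; rule haar_mono) (use assms in auto)

lemma haar_zero: "I (\<lambda>x. 0) = 0"
  using haar_scale[OF Cc_zero, of 0] by simp

lemma haar_sum:
  assumes "finite A" "\<And>i. i \<in> A \<Longrightarrow> f i \<in> Cc"
  shows "I (\<lambda>x. \<Sum>i\<in>A. f i x) = (\<Sum>i\<in>A. I (f i))"
  using assms by (induction rule: finite_induct) (auto simp: haar_zero haar_add Cc_sum)

lemma haar_Cauchy_Schwarz:
  assumes f: "f \<in> Cc" and h: "h \<in> Cc"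
  shows "(I (\<lambda>x. f x * h x))\<^sup>2 \<le> I (\<lambda>x. (f x)\<^sup>2) * I (\<lambda>x. (h x)\<^sup>2)"
proof -
  \<comment> \<open>The usual discriminant argument; the seminorm may have a kernel, so \<open>a = 0\<close> is treated apart.\<close>
  define a b c where "a = I (\<lambda>x. (f x)\<^sup>2)" and "b = I (\<lambda>x. f x * h x)" and "c = I (\<lambda>x. (h x)\<^sup>2)"
  have quad: "0 \<le> t\<^sup>2 * a - 2 * t * b + c" for t
  proof -
    have "0 \<le> I (\<lambda>x. (t * f x - h x)\<^sup>2)"
      by (intro haar_nonneg Cc_power2 Cc_diff Cc_scale f h) auto
    also have "(\<lambda>x. (t * f x - h x)\<^sup>2) = (\<lambda>x. (t\<^sup>2 * (f x)\<^sup>2 - (2 * t) * (f x * h x)) + (h x)\<^sup>2)"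
      by (rule ext) (simp add: power2_eq_square algebra_simps)
    also have "I \<dots> = I (\<lambda>x. t\<^sup>2 * (f x)\<^sup>2 - (2 * t) * (f x * h x)) + c"
      unfolding c_def by (intro haar_add Cc_diff Cc_scale Cc_power2 Cc_mult f h)
    also have "I (\<lambda>x. t\<^sup>2 * (f x)\<^sup>2 - (2 * t) * (f x * h x)) = I (\<lambda>x. t\<^sup>2 * (f x)\<^sup>2) - I (\<lambda>x. (2 * t) * (f x * h x))"
      by (intro haar_diff Cc_scale Cc_power2 Cc_mult f h)
    also have "\<dots> = t\<^sup>2 * a - 2 * t * b"
      unfolding a_def b_def by (simp only: haar_scale[OF Cc_power2[OF f]] haar_scale[OF Cc_mult[OF f h]])
    finally show ?thesis .
  qed
  have a0: "0 \<le> a" unfolding a_def by (intro haar_nonneg Cc_power2 f) auto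
  show ?thesis
  proof (cases "a = 0")
    case True
    have "b = 0"
    proof (rule ccontr)
      assume "b \<noteq> 0"
      with quad[of "(c + 1) / (2 * b)"] True show False by (simp add: field_simps)
    qed
    then show ?thesis using True by (simp add: a_def b_def)
  next
    case False
    with a0 have "0 < a" by simp
    with quad[of "b / a"] have "b\<^sup>2 \<le> a * c"
      by (simp add: power2_eq_square field_simps)
    then show ?thesis by (simp add: a_def b_def c_def)
  qed
qed

end

section \<open>Random walks\<close>

text \<open>
  \<open>walk_mean B k F\<close> is the expectation of \<open>F\<close> at the position after \<open>2 ^ k\<close> independent steps
  uniform on \<open>B\<close>: the position at time \<open>2 ^ (k + 1)\<close> is the product of two independent
  positions at time \<open>2 ^ k\<close>. Doubling the time is all that the energy estimate
  and the norm estimate need.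
\<close>

primrec walk_mean :: "'a set \<Rightarrow> nat \<Rightarrow> ('a \<Rightarrow> 'v) \<Rightarrow> 'v::real_vector" where
  "walk_mean B 0 = (\<lambda>F. (1 / real (card B)) *\<^sub>R (\<Sum>s\<in>B. F s))"
| "walk_mean B (Suc k) = (\<lambda>F. walk_mean B k (\<lambda>x. walk_mean B k (\<lambda>y. F (x \<otimes> y))))"

context
  fixes B assumes B: "finite B" "B \<noteq> {}" "B \<subseteq> carrier G" "\<forall>s\<in>B. inv s \<in> B"
begin

lemma walk_mean_cong:
  "(\<And>x. x \<in> carrier G \<Longrightarrow> F x = F' x) \<Longrightarrow> walk_mean B k F = walk_mean B k F'"
proof (induction k arbitrary: F F')
  case 0
  then have "(\<Sum>s\<in>B. F s) = (\<Sum>s\<in>B. F' s)" using B(3) by (intro sum.cong) auto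
  then show ?case by simp
next
  case (Suc k)
  show ?case
    unfolding walk_mean.simps by (intro Suc.IH Suc.prems) auto
qed

lemma walk_mean_linear:
  assumes "linear f"
  shows "f (walk_mean B k F) = walk_mean B k (\<lambda>x. f (F x))"
  by (induction k arbitrary: F) (simp_all add: linear_scale[OF assms] linear_sum[OF assms])

lemma walk_mean_add: "walk_mean B k (\<lambda>x. F x + H x) = walk_mean B k F + walk_mean B k H"
  by (induction k arbitrary: F H) (simp_all add: sum.distrib scaleR_add_right)

lemma walk_mean_const: "walk_mean B k (\<lambda>x. c) = c"
  using B(1,2) by (induction k) (simp_all add: scaleR_sum_right[symmetric] sum_constant_scaleR)

lemma walk_mean_scale: "walk_mean B k (\<lambda>x. c * F x) = c * walk_mean B k F" for c :: real
  by (rule walk_mean_linear[symmetric]) (simp add: linear_times)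

lemma walk_mean_diff: "walk_mean B k (\<lambda>x. F x - H x) = walk_mean B k F - walk_mean B k H" for F :: "'a \<Rightarrow> real"
  using walk_mean_add[of k F "\<lambda>x. - 1 * H x"] walk_mean_scale[of k "- 1" H] by simp

lemma walk_mean_mono:
  fixes F H :: "'a \<Rightarrow> real"
  shows "(\<And>x. x \<in> carrier G \<Longrightarrow> F x \<le> H x) \<Longrightarrow> walk_mean B k F \<le> walk_mean B k H"
proof (induction k arbitrary: F H)
  case 0
  then have "(\<Sum>s\<in>B. F s) \<le> (\<Sum>s\<in>B. H s)" using B(3) by (intro sum_mono) auto
  then show ?case by (simp add: divide_right_mono)
next
  case (Suc k)
  show ?case
    unfolding walk_mean.simps by (intro Suc.IH Suc.prems) auto
qed

lemma walk_mean_sum: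
  "walk_mean B k (\<lambda>x. \<Sum>i\<in>A. H i x) = (\<Sum>i\<in>A. walk_mean B k (H i))"
  by (induction A rule: infinite_finite_induct) (simp_all add: walk_mean_const walk_mean_add)

lemma walk_mean_swap:
  fixes H :: "'a \<Rightarrow> 'a \<Rightarrow> 'v::real_vector"
  shows "walk_mean B k (\<lambda>x. walk_mean B l (\<lambda>y. H x y)) = walk_mean B l (\<lambda>y. walk_mean B k (\<lambda>x. H x y))"
proof (induction l arbitrary: H)
  case 0
  have "linear (\<lambda>v::'v. (1 / real (card B)) *\<^sub>R v)" by (simp add: linear_iff scaleR_add_right)
  from walk_mean_linear[OF this] show ?case
    by (simp add: walk_mean_sum[symmetric])
next
  case (Suc l)
  then show ?case by simp
qed

lemma walk_mean_inv: "walk_mean B k (\<lambda>x. F (inv x)) = walk_mean B k F"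
proof (induction k arbitrary: F)
  case 0
  have "bij_betw (\<lambda>x. inv x) B B"
    using B(3,4) by (intro bij_betwI[of _ _ _ "\<lambda>x. inv x"]) auto
  then have "(\<Sum>s\<in>B. F (inv s)) = (\<Sum>s\<in>B. F s)" by (rule sum.reindex_bij_betw)
  then show ?case by simp
next
  case (Suc k)
  have "walk_mean B (Suc k) (\<lambda>x. F (inv x)) = walk_mean B k (\<lambda>x. walk_mean B k (\<lambda>y. F (inv y \<otimes> inv x)))"
    unfolding walk_mean.simps by (intro walk_mean_cong) (simp add: inv_mult_group)
  also have "\<dots> = walk_mean B k (\<lambda>x. walk_mean B k (\<lambda>y. F (y \<otimes> inv x)))"
    by (simp only: Suc.IH[of "\<lambda>y. F (y \<otimes> inv x)" for x])
  also have "\<dots> = walk_mean B k (\<lambda>x. walk_mean B k (\<lambda>y. F (y \<otimes> x)))"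
    by (rule Suc.IH)
  also have "\<dots> = walk_mean B (Suc k) F"
    unfolding walk_mean.simps by (rule walk_mean_swap)
  finally show ?case .
qed

text \<open>
  The expected squared displacement grows at most linearly in time. Since the walk is symmetric,
  the displacement over twice the time is the distance between two independent copies, and the cross
  term \<open>-2 \<parallel>E b\<parallel>\<^sup>2\<close> is favourable.
\<close>

lemma walk_mean_energy:
  fixes b :: "'a \<Rightarrow> 'v::real_inner"
  assumes b: "\<And>g h. g \<in> carrier G \<Longrightarrow> h \<in> carrier G \<Longrightarrow> norm (b (g \<otimes> h)) = norm (b h - b (inv g))"
  shows "walk_mean B k (\<lambda>g. (norm (b g))\<^sup>2) \<le> 2 ^ k * walk_mean B 0 (\<lambda>g. (norm (b g))\<^sup>2)"
proof (induction k)
  case (Suc k)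
  let ?\<psi> = "\<lambda>g. (norm (b g))\<^sup>2"
  have "walk_mean B (Suc k) ?\<psi> = walk_mean B k (\<lambda>x. walk_mean B k (\<lambda>y. (norm (b y - b (inv x)))\<^sup>2))"
    unfolding walk_mean.simps by (intro walk_mean_cong) (simp add: b)
  also have "\<dots> = walk_mean B k (\<lambda>x. walk_mean B k (\<lambda>y. (norm (b y - b x))\<^sup>2))"
    by (rule walk_mean_inv)
  also have "\<dots> = walk_mean B k (\<lambda>x. walk_mean B k (\<lambda>y. ?\<psi> y + ?\<psi> x - 2 * inner (b x) (b y)))"
    by (simp add: power2_norm_eq_inner inner_diff_left inner_diff_right inner_commute algebra_simps)
  also have "\<dots> = 2 * walk_mean B k ?\<psi> - 2 * walk_mean B k (\<lambda>x. walk_mean B k (\<lambda>y. inner (b x) (b y)))"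
    by (simp add: walk_mean_diff walk_mean_add walk_mean_const walk_mean_scale)
  also have "walk_mean B k (\<lambda>x. walk_mean B k (\<lambda>y. inner (b x) (b y))) = inner (walk_mean B k b) (walk_mean B k b)"
  proof -
    have "walk_mean B k (\<lambda>y. inner (b x) (b y)) = inner (b x) (walk_mean B k b)" for x
      by (rule walk_mean_linear[symmetric]) (simp add: linear_iff inner_add_right)
    moreover have "walk_mean B k (\<lambda>x. inner (b x) v) = inner (walk_mean B k b) v" for v
      by (rule walk_mean_linear[symmetric, where f = "\<lambda>u. inner u v"]) (simp add: linear_iff inner_add_left)
    ultimately show ?thesis by simp
  qed
  also have "2 * walk_mean B k ?\<psi> - 2 * inner (walk_mean B k b) (walk_mean B k b) \<le> 2 * walk_mean B k ?\<psi>"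
    by simp
  also have "\<dots> \<le> 2 ^ Suc k * walk_mean B 0 ?\<psi>" using Suc.IH by (simp only: power_Suc mult.assoc mult_le_cancel_left_pos)
  finally show ?case .
qed simp

lemma walk_mean_Cc:
  "(\<And>g. g \<in> carrier G \<Longrightarrow> H g \<in> Cc) \<Longrightarrow> (\<lambda>x. walk_mean B k (\<lambda>g. H g x)) \<in> Cc"
proof (induction k arbitrary: H)
  case 0
  then show ?case using B(1,3) by (auto intro!: Cc_scale[of _ "1 / real (card B)", simplified] Cc_sum)
next
  case (Suc k)
  show ?case unfolding walk_mean.simps by (intro Suc.IH Suc.prems) auto
qed

context
  fixes I assumes I: "haar_functional I"
begin

lemma haar_walk_mean:
  "(\<And>g. g \<in> carrier G \<Longrightarrow> H g \<in> Cc) \<Longrightarrow>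
    I (\<lambda>x. walk_mean B k (\<lambda>g. H g x)) = walk_mean B k (\<lambda>g. I (H g))"
proof (induction k arbitrary: H)
  case 0
  have "I (\<lambda>x. (1 / real (card B)) * (\<Sum>s\<in>B. H s x)) = (1 / real (card B)) * (\<Sum>s\<in>B. I (H s))"
    using B(1,3) 0 by (subst haar_scale[OF I]) (auto intro!: Cc_sum simp: haar_sum[OF I] subset_iff)
  then show ?case by simp
next
  case (Suc k)
  have "I (\<lambda>x. walk_mean B k (\<lambda>u. walk_mean B k (\<lambda>v. H (u \<otimes> v) x))) =
      walk_mean B k (\<lambda>u. I (\<lambda>x. walk_mean B k (\<lambda>v. H (u \<otimes> v) x)))"
    by (rule Suc.IH) (intro walk_mean_Cc Suc.prems, simp)
  also have "\<dots> = walk_mean B k (\<lambda>u. walk_mean B k (\<lambda>v. I (H (u \<otimes> v))))"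
    by (intro walk_mean_cong Suc.IH Suc.prems) simp
  finally show ?case by simp
qed

text \<open>
  Doubling the time composes the averaging operator with itself, so a contraction factor \<open>\<theta>\<close> for
  one step becomes \<open>\<theta> ^ (2 ^ k)\<close>.
\<close>

lemma walk_contraction:
  assumes gap: "\<And>\<xi>. \<xi> \<in> Cc \<Longrightarrow> I (\<lambda>x. (walk_mean B 0 (\<lambda>g. \<xi> (g \<otimes> x)))\<^sup>2) \<le> \<theta> * I (\<lambda>x. (\<xi> x)\<^sup>2)"
    and \<theta>: "0 \<le> \<theta>" and \<xi>: "\<xi> \<in> Cc"
  shows "I (\<lambda>x. (walk_mean B k (\<lambda>g. \<xi> (g \<otimes> x)))\<^sup>2) \<le> \<theta> ^ (2 ^ k) * I (\<lambda>x. (\<xi> x)\<^sup>2)"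
  using \<xi>
proof (induction k arbitrary: \<xi>)
  case 0
  then show ?case using gap by simp
next
  case (Suc k)
  define \<eta> where "\<eta> = (\<lambda>x. walk_mean B k (\<lambda>g. \<xi> (g \<otimes> x)))"
  have \<eta>: "\<eta> \<in> Cc" unfolding \<eta>_def by (intro walk_mean_Cc Cc_translate Suc.prems)
  have PC: "(\<lambda>x. walk_mean B l (\<lambda>g. \<zeta> (g \<otimes> x))) \<in> Cc" if "\<zeta> \<in> Cc" for l \<zeta>
    using that by (intro walk_mean_Cc Cc_translate)
  have "walk_mean B (Suc k) (\<lambda>g. \<xi> (g \<otimes> x)) = walk_mean B k (\<lambda>g. \<eta> (g \<otimes> x))" if x: "x \<in> carrier G" for x
  proof -
    have "walk_mean B (Suc k) (\<lambda>g. \<xi> (g \<otimes> x)) = walk_mean B k (\<lambda>u. walk_mean B k (\<lambda>v. \<xi> (u \<otimes> (v \<otimes> x))))"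
      unfolding walk_mean.simps using x by (intro walk_mean_cong) (simp add: m_assoc)
    also have "\<dots> = walk_mean B k (\<lambda>v. walk_mean B k (\<lambda>u. \<xi> (u \<otimes> (v \<otimes> x))))"
      by (rule walk_mean_swap)
    finally show ?thesis by (simp add: \<eta>_def)
  qed
  then have "I (\<lambda>x. (walk_mean B (Suc k) (\<lambda>g. \<xi> (g \<otimes> x)))\<^sup>2) = I (\<lambda>x. (walk_mean B k (\<lambda>g. \<eta> (g \<otimes> x)))\<^sup>2)"
    by (intro haar_cong[OF I] Cc_power2 PC Suc.prems \<eta>) simp
  also have "\<dots> \<le> \<theta> ^ (2 ^ k) * I (\<lambda>x. (\<eta> x)\<^sup>2)" by (rule Suc.IH[OF \<eta>])
  also have "\<dots> \<le> \<theta> ^ (2 ^ k) * (\<theta> ^ (2 ^ k) * I (\<lambda>x. (\<xi> x)\<^sup>2))"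
    unfolding \<eta>_def using \<theta> by (intro mult_left_mono Suc.IH Suc.prems) simp
  also have "\<dots> = \<theta> ^ (2 ^ Suc k) * I (\<lambda>x. (\<xi> x)\<^sup>2)"
    by (simp add: power_add[symmetric] mult_2)
  finally show ?case .
qed

text \<open>
  The average of vectors of equal norm is shorter by a definite amount if two of them are apart.
  The pair used here is the translate by \<open>g\<close> and the translate by \<open>\<one>\<close>, hence the requirement
  \<open>\<one> \<in> B\<close>.
\<close>

lemma walk_step_contraction:
  assumes g: "g \<in> B" and one: "\<one> \<in> B" and \<xi>: "\<xi> \<in> Cc"
    and far: "\<epsilon> * I (\<lambda>x. (\<xi> x)\<^sup>2) \<le> I (\<lambda>x. (\<xi> (g \<otimes> x) - \<xi> x)\<^sup>2)"
  shows "I (\<lambda>x. (walk_mean B 0 (\<lambda>s. \<xi> (s \<otimes> x)))\<^sup>2) \<le> (1 - \<epsilon> / (2 * (real (card B))\<^sup>2)) * I (\<lambda>x. (\<xi> x)\<^sup>2)"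
proof -
  define m where "m = real (card B)"
  have m: "0 < m" using B(1,2) by (simp add: m_def card_gt_0_iff)
  have gG: "g \<in> carrier G" using g B(3) by auto
  have tC: "(\<lambda>x. \<xi> (s \<otimes> x)) \<in> Cc" if "s \<in> B" for s using that B(3) by (intro Cc_translate \<xi>) auto
  have sC: "(\<lambda>x. \<Sum>s\<in>B. (\<xi> (s \<otimes> x))\<^sup>2) \<in> Cc" using tC by (intro Cc_sum B(1) Cc_power2) auto
  have dC: "(\<lambda>x. (\<xi> (g \<otimes> x) - \<xi> x)\<^sup>2) \<in> Cc" using g by (intro Cc_power2 Cc_diff tC \<xi>)
  have "I (\<lambda>x. (walk_mean B 0 (\<lambda>s. \<xi> (s \<otimes> x)))\<^sup>2) \<le>
      I (\<lambda>x. (1 / m) * (\<Sum>s\<in>B. (\<xi> (s \<otimes> x))\<^sup>2) - (1 / (2 * m\<^sup>2)) * (\<xi> (g \<otimes> x) - \<xi> x)\<^sup>2)"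
  proof (intro haar_mono[OF I] Cc_power2 walk_mean_Cc Cc_diff Cc_scale sC dC Cc_translate \<xi>)
    fix x assume x: "x \<in> carrier G"
    have "(\<Sum>s\<in>B. \<xi> (s \<otimes> x))\<^sup>2 \<le> m * (\<Sum>s\<in>B. (\<xi> (s \<otimes> x))\<^sup>2) - (\<xi> (g \<otimes> x) - \<xi> (\<one> \<otimes> x))\<^sup>2 / 2"
      unfolding m_def by (rule sum_power2_le_card_sum_power2_minus[OF B(1) g one])
    then have "(\<Sum>s\<in>B. \<xi> (s \<otimes> x))\<^sup>2 / m\<^sup>2 \<le> (m * (\<Sum>s\<in>B. (\<xi> (s \<otimes> x))\<^sup>2) - (\<xi> (g \<otimes> x) - \<xi> x)\<^sup>2 / 2) / m\<^sup>2"
      using x by (simp add: divide_right_mono)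
    then show "(walk_mean B 0 (\<lambda>s. \<xi> (s \<otimes> x)))\<^sup>2 \<le>
        (1 / m) * (\<Sum>s\<in>B. (\<xi> (s \<otimes> x))\<^sup>2) - (1 / (2 * m\<^sup>2)) * (\<xi> (g \<otimes> x) - \<xi> x)\<^sup>2"
      using m by (simp add: m_def[symmetric] power_divide diff_divide_distrib power2_eq_square)
  qed (use gG in auto)
  also have "\<dots> = I (\<lambda>x. (1 / m) * (\<Sum>s\<in>B. (\<xi> (s \<otimes> x))\<^sup>2)) - I (\<lambda>x. (1 / (2 * m\<^sup>2)) * (\<xi> (g \<otimes> x) - \<xi> x)\<^sup>2)"
    by (intro haar_diff[OF I] Cc_scale sC dC)
  also have "I (\<lambda>x. (1 / (2 * m\<^sup>2)) * (\<xi> (g \<otimes> x) - \<xi> x)\<^sup>2) = (1 / (2 * m\<^sup>2)) * I (\<lambda>x. (\<xi> (g \<otimes> x) - \<xi> x)\<^sup>2)"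
    by (rule haar_scale[OF I dC])
  also have "I (\<lambda>x. (1 / m) * (\<Sum>s\<in>B. (\<xi> (s \<otimes> x))\<^sup>2)) = (1 / m) * (\<Sum>s\<in>B. I (\<lambda>x. (\<xi> (s \<otimes> x))\<^sup>2))"
    using tC by (subst haar_scale[OF I sC], subst haar_sum[OF I B(1)]) (auto intro: Cc_power2)
  also have "(\<Sum>s\<in>B. I (\<lambda>x. (\<xi> (s \<otimes> x))\<^sup>2)) = m * I (\<lambda>x. (\<xi> x)\<^sup>2)"
    using haar_translate[OF I Cc_power2[OF \<xi>]] B(3) by (simp add: m_def subset_iff)
  also have "1 / m * (m * I (\<lambda>x. (\<xi> x)\<^sup>2)) - 1 / (2 * m\<^sup>2) * I (\<lambda>x. (\<xi> (g \<otimes> x) - \<xi> x)\<^sup>2) \<le>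
      1 / m * (m * I (\<lambda>x. (\<xi> x)\<^sup>2)) - 1 / (2 * m\<^sup>2) * (\<epsilon> * I (\<lambda>x. (\<xi> x)\<^sup>2))"
    by (intro diff_left_mono mult_left_mono far) simp
  also have "\<dots> = (1 - \<epsilon> / (2 * m\<^sup>2)) * I (\<lambda>x. (\<xi> x)\<^sup>2)"
    using m by (simp add: algebra_simps)
  finally show ?thesis by (simp add: m_def)
qed

end

end

end

section \<open>Growth of word balls\<close>

context locally_compact_group
begin

primrec product_power :: "'a set \<Rightarrow> nat \<Rightarrow> 'a set" where
  "product_power S 0 = {\<one>}"
| "product_power S (Suc n) = product_power S n <#> S"

lemma product_power_carrier: "S \<subseteq> carrier G \<Longrightarrow> product_power S n \<subseteq> carrier G"
  by (induction n) (simp_all add: set_mult_closed)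

lemma compactin_product_power: "compactin T S \<Longrightarrow> compactin T (product_power S n)"
  by (induction n) (simp_all add: compactin_set_mult compactin_sing topspace_eq)

lemma product_power_mono:
  assumes "S \<subseteq> carrier G" "\<one> \<in> S" "m \<le> n"
  shows "product_power S m \<subseteq> product_power S n"
proof (rule lift_Suc_mono_le[OF _ assms(3)])
  fix n
  show "product_power S n \<subseteq> product_power S (Suc n)"
  proof
    fix x assume x: "x \<in> product_power S n"
    then have "x = x \<otimes> \<one>" using subsetD[OF product_power_carrier[OF assms(1)] x] by simp
    then show "x \<in> product_power S (Suc n)"
      using x assms(2) by (auto simp: set_mult_def)
  qed
qed

lemma foldr_mult_closed: "set ss \<subseteq> carrier G \<Longrightarrow> a \<in> carrier G \<Longrightarrow> foldr (\<otimes>) ss a \<in> carrier G"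
  by (induction ss) auto

lemma foldr_mult_eq: "set ss \<subseteq> carrier G \<Longrightarrow> a \<in> carrier G \<Longrightarrow> foldr (\<otimes>) ss a = foldr (\<otimes>) ss \<one> \<otimes> a"
  by (induction ss) (auto simp: m_assoc foldr_mult_closed)

lemma foldr_mult_in_product_power:
  "set ss \<subseteq> S \<Longrightarrow> S \<subseteq> carrier G \<Longrightarrow> foldr (\<otimes>) ss \<one> \<in> product_power S (length ss)"
proof (induction ss rule: rev_induct)
  case (snoc s ss)
  then have "s \<in> carrier G" "set ss \<subseteq> carrier G" by auto
  then have "foldr (\<otimes>) (ss @ [s]) \<one> = foldr (\<otimes>) ss \<one> \<otimes> s"
    using foldr_mult_eq[of ss s] by simp
  with snoc show ?case by (auto simp: set_mult_def)
qed simp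

lemma generate_imp_foldr_mult:
  assumes "h \<in> generate G S" "S \<subseteq> carrier G" "\<And>s. s \<in> S \<Longrightarrow> inv s \<in> S"
  shows "\<exists>ss. set ss \<subseteq> S \<and> foldr (\<otimes>) ss \<one> = h"
  using assms(1)
proof (induction h rule: generate.induct)
  case one
  show ?case by (rule exI[of _ "[]"]) simp
next
  case (incl h)
  then show ?case using assms(2) by (intro exI[of _ "[h]"]) auto
next
  case (inv h)
  then show ?case using assms(2,3) by (intro exI[of _ "[inv h]"]) auto
next
  case (eng h1 h2)
  then obtain ss ts where st: "set ss \<subseteq> S" "foldr (\<otimes>) ss \<one> = h1" "set ts \<subseteq> S" "foldr (\<otimes>) ts \<one> = h2"
    by auto
  have "foldr (\<otimes>) (ss @ ts) \<one> = h1 \<otimes> h2"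
    using foldr_mult_eq[of ss h2] foldr_mult_closed[of ts \<one>] st assms(2) by auto
  then show ?case using st by (intro exI[of _ "ss @ ts"]) auto
qed

lemma word_ball_subset_product_power:
  assumes S: "compact_symmetric_generating_set G T S" and S': "S \<subseteq> S'" "S' \<subseteq> carrier G" "\<one> \<in> S'"
    and g: "g \<in> carrier G" "word_length G S g \<le> n"
  shows "g \<in> product_power S' n"
proof -
  have SG: "S \<subseteq> carrier G" using S' by auto
  have gen: "g \<in> generate G S" using S g(1) by (simp add: compact_symmetric_generating_set_def)
  have "\<exists>ss. set ss \<subseteq> S \<and> foldr (\<otimes>) ss \<one> = g"
    by (rule generate_imp_foldr_mult[OF gen SG]) (use S in \<open>simp add: compact_symmetric_generating_set_def\<close>)
  then have "\<exists>n ss. length ss = n \<and> set ss \<subseteq> S \<and> foldr (\<otimes>) ss \<one> = g" by blast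
  from LeastI_ex[OF this] obtain ss where ss: "length ss = word_length G S g" "set ss \<subseteq> S" "foldr (\<otimes>) ss \<one> = g"
    unfolding word_length_def by blast
  then have "g \<in> product_power S' (word_length G S g)"
    using foldr_mult_in_product_power[of ss S'] S' by auto
  then show ?thesis using product_power_mono[OF S'(2,3) g(2)] by blast
qed

text \<open>
  Left translates are counted, as the Haar functional is left invariant. Therefore the powers are
  extended on the right: \<open>S\<^sup>n S\<close> covered by translates \<open>y\<^sup>-\<^sup>1 S\<close> gives \<open>S\<^sup>n S S\<close> covered by
  \<open>y\<^sup>-\<^sup>1 S S\<close>, and \<open>S S\<close> is covered by a fixed number \<open>N\<close> of translates of \<open>V \<subseteq> S\<close>.
\<close>

lemma product_power_covering:
  assumes S: "compactin T S" and V: "openin T V" "v \<in> V" "V \<subseteq> S"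
  obtains N where "\<forall>n. \<exists>Y. finite Y \<and> Y \<subseteq> carrier G \<and> card Y \<le> N ^ n \<and>
    (\<forall>x\<in>product_power S n <#> S. \<exists>y\<in>Y. y \<otimes> x \<in> S)"
proof -
  have SG: "S \<subseteq> carrier G" by (rule compactin_carrier[OF S])
  obtain A where A: "finite A" "A \<subseteq> carrier G" "\<forall>x\<in>S <#> S. \<exists>a\<in>A. a \<otimes> x \<in> V"
    by (rule compact_covered_by_translates[OF compactin_set_mult[OF S S] V(1,2)])
  have "\<exists>Y. finite Y \<and> Y \<subseteq> carrier G \<and> card Y \<le> card A ^ n \<and>
    (\<forall>x\<in>product_power S n <#> S. \<exists>y\<in>Y. y \<otimes> x \<in> S)" for n
  proof (induction n)
    case 0
    show ?case using SG by (intro exI[of _ "{\<one>}"]) (auto simp: set_mult_def subset_iff)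
  next
    case (Suc n)
    then obtain Y where Y: "finite Y" "Y \<subseteq> carrier G" "card Y \<le> card A ^ n"
      "\<forall>x\<in>product_power S n <#> S. \<exists>y\<in>Y. y \<otimes> x \<in> S" by blast
    let ?Y = "(\<lambda>(a, y). a \<otimes> y) ` (A \<times> Y)"
    have "card ?Y \<le> card A * card Y"
      using card_image_le[of "A \<times> Y" "\<lambda>(a, y). a \<otimes> y"] A Y by (simp add: card_cartesian_product)
    also have "\<dots> \<le> card A ^ Suc n" using Y(3) by simp
    finally have c: "card ?Y \<le> card A ^ Suc n" .
    have "\<exists>y\<in>?Y. y \<otimes> x \<in> S" if x: "x \<in> product_power S (Suc n) <#> S" for x
    proof -
      obtain p s where ps: "x = p \<otimes> s" "p \<in> product_power S n <#> S" "s \<in> S"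
        using x unfolding product_power.simps set_mult_def[of G "product_power S n <#> S"] by blast
      have pG: "p \<in> carrier G" using ps(2) product_power_carrier[OF SG, of "Suc n"] by auto
      have sG: "s \<in> carrier G" using ps(3) SG by auto
      obtain y where y: "y \<in> Y" "y \<otimes> p \<in> S" using Y(4) ps(2) by blast
      have "(y \<otimes> p) \<otimes> s \<in> S <#> S" using y(2) ps(3) by (auto simp: set_mult_def)
      then obtain a where a: "a \<in> A" "a \<otimes> (y \<otimes> p \<otimes> s) \<in> V" using A(3) by blast
      have "a \<in> carrier G" "y \<in> carrier G" using a(1) y(1) A(2) Y(2) by auto
      then have "(a \<otimes> y) \<otimes> x = a \<otimes> (y \<otimes> p \<otimes> s)"
        using pG sG by (simp add: ps(1) m_assoc)
      then show ?thesis using a V(3) y(1) by (intro bexI[of _ "a \<otimes> y"]) auto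
    qed
    moreover have "finite ?Y" "?Y \<subseteq> carrier G" using A Y by auto
    ultimately show ?case using c by (intro exI[of _ ?Y]) blast
  qed
  then show thesis by (intro that[of "card A"]) blast
qed

text \<open>
  By Markov's inequality the walk is in \<open>X\<close> with probability at least one half. On the inverse of
  \<open>X\<close>, which is as likely because \<open>\<psi>\<close> is symmetric, the translate \<open>w (g \<otimes> x)\<close> lives where the
  sum \<open>\<zeta>\<close> of translates of \<open>u\<close> is at least one. So the averaged function has integral at least
  \<open>I w / 2\<close> against \<open>\<zeta>\<close>, and the Cauchy-Schwarz inequality turns the bound
  \<open>card Y\<^sup>2 I(u\<^sup>2)\<close> on the norm of \<open>\<zeta>\<close> into a lower bound for its norm.
\<close>

lemma walk_return_lower_bound:
  assumes B: "finite B" "B \<noteq> {}" "B \<subseteq> carrier G" "\<forall>s\<in>B. inv s \<in> B"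
    and I: "haar_functional I"
    and w: "w \<in> Cc" "\<And>x. x \<in> carrier G \<Longrightarrow> 0 \<le> w x" "\<And>x. x \<in> carrier G - S \<Longrightarrow> w x = 0"
    and u: "u \<in> Cc" "\<And>x. x \<in> carrier G \<Longrightarrow> 0 \<le> u x" "\<And>x. x \<in> S \<Longrightarrow> u x = 1"
    and Y: "finite Y" "Y \<subseteq> carrier G" "\<And>x. x \<in> X <#> S \<Longrightarrow> \<exists>y\<in>Y. y \<otimes> x \<in> S"
    and \<psi>: "\<And>g. g \<in> carrier G \<Longrightarrow> \<psi> (inv g) = (\<psi> g :: real)" "\<And>g. g \<in> carrier G \<Longrightarrow> 0 \<le> \<psi> g"
      "\<And>g. g \<in> carrier G \<Longrightarrow> \<psi> g \<le> a \<Longrightarrow> g \<in> X"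
    and a: "0 < a" "walk_mean B k \<psi> \<le> a / 2"
  shows "(I w)\<^sup>2 / 4 \<le> I (\<lambda>x. (walk_mean B k (\<lambda>g. w (g \<otimes> x)))\<^sup>2) * ((real (card Y))\<^sup>2 * I (\<lambda>x. (u x)\<^sup>2))"
proof -
  define \<zeta> where "\<zeta> = (\<lambda>x. \<Sum>y\<in>Y. u (y \<otimes> x))"
  have uC: "(\<lambda>x. u (y \<otimes> x)) \<in> Cc" if "y \<in> Y" for y using that Y(2) by (intro Cc_translate u) auto
  have \<zeta>C: "\<zeta> \<in> Cc" unfolding \<zeta>_def by (intro Cc_sum Y(1) uC)
  have \<zeta>0: "0 \<le> \<zeta> x" if "x \<in> carrier G" for x
    unfolding \<zeta>_def using that Y(2) by (intro sum_nonneg u) auto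
  have \<zeta>1: "1 \<le> \<zeta> x" if x: "x \<in> carrier G" "y \<in> Y" "y \<otimes> x \<in> S" for x y
  proof -
    have "u (y \<otimes> x) \<le> \<zeta> x"
      unfolding \<zeta>_def using x Y(2) by (intro member_le_sum[of y Y "\<lambda>y. u (y \<otimes> x)"] Y(1) u(2)) auto
    then show ?thesis using u(3)[OF x(3)] by simp
  qed
  have Iw: "0 \<le> I w" by (rule haar_nonneg[OF I w(1,2)])
  have PC: "(\<lambda>x. walk_mean B k (\<lambda>g. w (g \<otimes> x))) \<in> Cc"
    by (intro walk_mean_Cc[OF B] Cc_translate w)
  have wC: "(\<lambda>x. \<zeta> x * w (g \<otimes> x)) \<in> Cc" if "g \<in> carrier G" for g
    using that by (intro Cc_mult Cc_translate \<zeta>C w)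
  \<comment> \<open>Markov's inequality in pointwise form: \<open>1 - \<psi> / a\<close> bounds the indicator of \<open>\<psi> \<le> a\<close>
      from below.\<close>
  have low: "(1 - \<psi> g / a) * I w \<le> I (\<lambda>x. \<zeta> x * w (g \<otimes> x))" if g: "g \<in> carrier G" for g
  proof (cases "\<psi> g \<le> a")
    case True
    have "inv g \<in> X" using \<psi>(1)[OF g] True g by (intro \<psi>(3)) auto
    have "(1 - \<psi> g / a) * I w \<le> 1 * I w"
      using \<psi>(2)[OF g] a(1) Iw by (intro mult_right_mono) auto
    also have "1 * I w = I (\<lambda>x. w (g \<otimes> x))" using haar_translate[OF I w(1) g] by simp
    also have "\<dots> \<le> I (\<lambda>x. \<zeta> x * w (g \<otimes> x))"
    proof (rule haar_mono[OF I Cc_translate[OF w(1) g] wC[OF g]])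
      fix x assume x: "x \<in> carrier G"
      show "w (g \<otimes> x) \<le> \<zeta> x * w (g \<otimes> x)"
      proof (cases "g \<otimes> x \<in> S")
        case True
        have "x = inv g \<otimes> (g \<otimes> x)" using g x by (simp add: m_assoc[symmetric])
        then have "x \<in> X <#> S" using True \<open>inv g \<in> X\<close> unfolding set_mult_def by blast
        then obtain y where y: "y \<in> Y" "y \<otimes> x \<in> S" using Y(3) by blast
        have "1 * w (g \<otimes> x) \<le> \<zeta> x * w (g \<otimes> x)"
          using g x by (intro mult_right_mono \<zeta>1[OF x y] w(2)) auto
        then show ?thesis by simp
      next
        case False
        then have "w (g \<otimes> x) = 0" using g x by (intro w(3)) auto
        then show ?thesis by simp
      qed
    qed
    finally show ?thesis .
  next
    case False
    then have "(1 - \<psi> g / a) * I w \<le> 0"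
      using Iw a(1) by (intro mult_nonpos_nonneg) (auto simp: field_simps)
    also have "0 \<le> I (\<lambda>x. \<zeta> x * w (g \<otimes> x))"
      using g by (intro haar_nonneg[OF I wC[OF g]] mult_nonneg_nonneg \<zeta>0 w(2)) auto
    finally show ?thesis .
  qed
  have "I w / 2 \<le> (1 - walk_mean B k \<psi> / a) * I w"
  proof -
    have "1 / 2 \<le> 1 - walk_mean B k \<psi> / a" using a by (simp add: field_simps)
    from mult_right_mono[OF this Iw] show ?thesis by simp
  qed
  also have "(1 - walk_mean B k \<psi> / a) * I w = walk_mean B k (\<lambda>g. (1 - \<psi> g / a) * I w)"
  proof -
    have "walk_mean B k (\<lambda>g. (1 - \<psi> g / a) * I w) = walk_mean B k (\<lambda>g. I w - (I w / a) * \<psi> g)"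
    proof (rule walk_mean_cong[OF B])
      fix g
      show "(1 - \<psi> g / a) * I w = I w - (I w / a) * \<psi> g" by (simp add: left_diff_distrib)
    qed
    also have "\<dots> = I w - (I w / a) * walk_mean B k \<psi>"
      by (simp only: walk_mean_diff[OF B] walk_mean_const[OF B] walk_mean_scale[OF B])
    also have "\<dots> = (1 - walk_mean B k \<psi> / a) * I w" by (simp add: left_diff_distrib)
    finally show ?thesis by (rule sym)
  qed
  also have "\<dots> \<le> walk_mean B k (\<lambda>g. I (\<lambda>x. \<zeta> x * w (g \<otimes> x)))"
    by (rule walk_mean_mono[OF B low])
  also have "\<dots> = I (\<lambda>x. walk_mean B k (\<lambda>g. \<zeta> x * w (g \<otimes> x)))"
    by (rule haar_walk_mean[OF B I wC, symmetric])
  also have "\<dots> = I (\<lambda>x. walk_mean B k (\<lambda>g. w (g \<otimes> x)) * \<zeta> x)"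
    by (simp add: walk_mean_scale[OF B] mult.commute)
  finally have half: "I w / 2 \<le> I (\<lambda>x. walk_mean B k (\<lambda>g. w (g \<otimes> x)) * \<zeta> x)" .
  have \<zeta>2: "I (\<lambda>x. (\<zeta> x)\<^sup>2) \<le> (real (card Y))\<^sup>2 * I (\<lambda>x. (u x)\<^sup>2)"
  proof -
    have sC: "(\<lambda>x. \<Sum>y\<in>Y. (u (y \<otimes> x))\<^sup>2) \<in> Cc" by (intro Cc_sum Y(1) Cc_power2 uC)
    have "I (\<lambda>x. (\<zeta> x)\<^sup>2) \<le> I (\<lambda>x. real (card Y) * (\<Sum>y\<in>Y. (u (y \<otimes> x))\<^sup>2))"
      using sum_squared_le_sum_of_squares[of "\<lambda>y. u (y \<otimes> x)" Y for x]
      by (intro haar_mono[OF I] Cc_power2 \<zeta>C Cc_scale sC) (simp add: \<zeta>_def mult.commute)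
    also have "\<dots> = real (card Y) * (\<Sum>y\<in>Y. I (\<lambda>x. (u (y \<otimes> x))\<^sup>2))"
      using uC by (subst haar_scale[OF I sC], subst haar_sum[OF I Y(1)]) (auto intro: Cc_power2)
    also have "(\<Sum>y\<in>Y. I (\<lambda>x. (u (y \<otimes> x))\<^sup>2)) = real (card Y) * I (\<lambda>x. (u x)\<^sup>2)"
      using haar_translate[OF I Cc_power2[OF u(1)]] Y(2) by (simp add: subset_iff)
    finally show ?thesis by (simp add: power2_eq_square)
  qed
  have "(I w)\<^sup>2 / 4 = (I w / 2)\<^sup>2" by (simp add: power2_eq_square)
  also have "\<dots> \<le> (I (\<lambda>x. walk_mean B k (\<lambda>g. w (g \<otimes> x)) * \<zeta> x))\<^sup>2"
    using half Iw by (intro power_mono) auto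
  also have "\<dots> \<le> I (\<lambda>x. (walk_mean B k (\<lambda>g. w (g \<otimes> x)))\<^sup>2) * I (\<lambda>x. (\<zeta> x)\<^sup>2)"
    by (rule haar_Cauchy_Schwarz[OF I PC \<zeta>C])
  also have "\<dots> \<le> I (\<lambda>x. (walk_mean B k (\<lambda>g. w (g \<otimes> x)))\<^sup>2) * ((real (card Y))\<^sup>2 * I (\<lambda>x. (u x)\<^sup>2))"
    by (intro mult_left_mono \<zeta>2 haar_nonneg[OF I] Cc_power2 PC) simp
  finally show ?thesis .
qed

end

section \<open>Almost invariant vectors and means\<close>

context locally_compact_group
begin

text \<open>
  If no vector is almost invariant under \<open>F\<close>, the squared norm of the averaged \<open>w\<close> decays at
  least like \<open>\<theta>\<^sup>n\<close>, whereas the growth hypothesis forces decay no faster than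
  \<open>N'\<^sup>-\<^sup>2\<^sup>\<eta>\<^sup>n\<close> along \<open>n = 2\<^sup>k\<close>.
\<close>

lemma almost_invariant_vectors:
  fixes b :: "'a \<Rightarrow> 'v::real_inner"
  assumes S: "compact_symmetric_generating_set G T S"
    and b: "\<And>g h. g \<in> carrier G \<Longrightarrow> h \<in> carrier G \<Longrightarrow> norm (b (g \<otimes> h)) = norm (b h - b (inv g))"
    and growth: "\<And>\<eta>. 0 < \<eta> \<Longrightarrow> \<exists>K. compactin T K \<and>
      (\<forall>g\<in>carrier G - K. real (word_length G S g) \<le> \<eta> * (norm (b g))\<^sup>2)"
    and F: "finite F" "F \<subseteq> carrier G" and \<epsilon>: "0 < \<epsilon>" "\<epsilon> \<le> 1"
  shows "\<exists>I \<xi>. haar_functional I \<and> \<xi> \<in> Cc \<and> 0 < I (\<lambda>x. (\<xi> x)\<^sup>2) \<and>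
    (\<forall>g\<in>F. I (\<lambda>x. (\<xi> (g \<otimes> x) - \<xi> x)\<^sup>2) \<le> \<epsilon> * I (\<lambda>x. (\<xi> x)\<^sup>2))"
proof -
  have one: "compactin T {\<one>}" by (simp add: compactin_sing topspace_eq)
  obtain w where w: "w \<in> Cc" "\<forall>x\<in>carrier G. 0 \<le> w x \<and> w x \<le> 1" "\<forall>x\<in>{\<one>}. w x = 1"
    by (rule Cc_bump[OF one openin_topspace compactin_subset_topspace[OF one]])
  obtain K0 where K0: "compactin T K0" "\<And>x. x \<in> carrier G - K0 \<Longrightarrow> w x = 0" using CcE[OF w(1)] by blast
  define V where "V = {x \<in> topspace T. w x \<in> {0<..}}"
  have Vop: "openin T V"
    unfolding V_def by (rule openin_continuous_map_preimage[OF Cc_continuous[OF w(1)]]) auto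
  have V1: "\<one> \<in> V" using w(3) by (simp add: V_def topspace_eq)
  \<comment> \<open>Enlarging the generating set only shortens words, so the growth hypothesis survives, and the
      enlarged set has interior and contains the support of \<open>w\<close>.\<close>
  define S' where "S' = S \<union> K0"
  have VK: "V \<subseteq> K0"
  proof
    fix x assume "x \<in> V"
    then have "x \<in> carrier G" "w x \<noteq> 0" by (auto simp: V_def topspace_eq)
    then show "x \<in> K0" using K0(2)[of x] by auto
  qed
  have VS: "V \<subseteq> S'" using VK by (auto simp: S'_def)
  have S'c: "compactin T S'"
    using S K0(1) by (simp add: S'_def compactin_Un compact_symmetric_generating_set_def)
  have S'G: "S' \<subseteq> carrier G" by (rule compactin_carrier[OF S'c])
  have oneS': "\<one> \<in> S'" using V1 VS by auto
  obtain u where u: "u \<in> Cc" "\<forall>x\<in>carrier G. 0 \<le> u x \<and> u x \<le> 1" "\<forall>x\<in>S'. u x = 1"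
    by (rule Cc_bump[OF S'c openin_topspace compactin_subset_topspace[OF S'c]])
  have "gauge_function w" using w by (auto simp: gauge_function_def intro!: bexI[of _ \<one>])
  then obtain I where I: "haar_functional I" "I w = 1" by (rule haar_functional_exists)
  obtain N where N: "\<forall>n. \<exists>Y. finite Y \<and> Y \<subseteq> carrier G \<and> card Y \<le> N ^ n \<and>
    (\<forall>x\<in>product_power S' n <#> S'. \<exists>y\<in>Y. y \<otimes> x \<in> S')"
    by (rule product_power_covering[OF S'c Vop V1 VS])
  define B where "B = insert \<one> (F \<union> (\<lambda>g. inv g) ` F)"
  have B: "finite B" "B \<noteq> {}" "B \<subseteq> carrier G" "\<forall>s\<in>B. inv s \<in> B" "\<one> \<in> B"
    using F by (auto simp: B_def subset_iff)
  note Bw = B(1-4)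
  define \<theta> where "\<theta> = 1 - \<epsilon> / (2 * (real (card B))\<^sup>2)"
  have cardB: "1 \<le> real (card B)" using B(1,2) by (simp add: Suc_le_eq card_gt_0_iff)
  have \<theta>: "0 < \<theta>" "\<theta> < 1"
  proof -
    have "1 \<le> (real (card B))\<^sup>2" using cardB by (rule one_le_power)
    then have "\<epsilon> < 2 * (real (card B))\<^sup>2" using \<epsilon> by linarith
    then show "0 < \<theta>" "\<theta> < 1" using \<epsilon> cardB by (simp_all add: \<theta>_def field_simps)
  qed
  define \<psi> where "\<psi> g = (norm (b g))\<^sup>2" for g
  \<comment> \<open>The summand 1 makes \<open>C\<close> positive even if \<open>\<psi>\<close> vanishes on \<open>B\<close>.\<close>
  define C where "C = walk_mean B 0 \<psi> + 1"
  have "walk_mean B 0 (\<lambda>x. 0) \<le> walk_mean B 0 \<psi>"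
    by (rule walk_mean_mono[OF Bw]) (simp add: \<psi>_def)
  then have C: "0 < C" using walk_mean_const[OF Bw, of 0 "0::real"] by (simp add: C_def)
  have b1: "b \<one> = 0" using b[of \<one> \<one>] by simp
  have \<psi>inv: "\<psi> (inv g) = \<psi> g" if "g \<in> carrier G" for g
    using b[OF that one_closed] that b1 by (simp add: \<psi>_def)
  \<comment> \<open>\<open>\<eta>\<close> is chosen such that \<open>\<theta> N'\<^sup>2\<^sup>\<eta> = \<theta>\<^sup>1\<^sup>/\<^sup>2 < 1\<close>; adding 2 keeps \<open>ln N'\<close> positive.\<close>
  define N' where "N' = real N + 2"
  define \<eta> where "\<eta> = - ln \<theta> / (4 * ln N')"
  have lnN: "0 < ln N'" by (simp add: N'_def)
  have "ln \<theta> < 0" using \<theta> by simp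
  then have \<eta>: "0 < \<eta>" using lnN by (simp add: \<eta>_def divide_neg_pos)
  have "0 < \<eta> / (2 * C)" using \<eta> C by simp
  from growth[OF this]
  obtain K where K: "compactin T K"
    "\<forall>g\<in>carrier G - K. real (word_length G S g) \<le> \<eta> / (2 * C) * (norm (b g))\<^sup>2"
    by blast
  obtain Z where Z: "finite Z" "Z \<subseteq> carrier G" "\<forall>x\<in>K <#> S'. \<exists>z\<in>Z. z \<otimes> x \<in> V"
    by (rule compact_covered_by_translates[OF compactin_set_mult[OF K(1) S'c] Vop V1])
  define U W where "U = I (\<lambda>x. (u x)\<^sup>2)" and "W = I (\<lambda>x. (w x)\<^sup>2)"
  have UW: "0 \<le> U" "0 \<le> W"
    unfolding U_def W_def by (intro haar_nonneg[OF I(1)] Cc_power2 u w; simp)+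
  define c where "c = W * ((real (card Z) + 1)\<^sup>2 * U)"
  have c0: "0 \<le> c" using UW by (simp add: c_def)
  define \<rho> where "\<rho> = \<theta> * N' powr (2 * \<eta>)"
  have "\<rho> = exp (ln \<theta> + 2 * \<eta> * ln N')" using \<theta>(1) by (simp add: \<rho>_def powr_def N'_def exp_add)
  also have "ln \<theta> + 2 * \<eta> * ln N' = ln \<theta> / 2" using lnN by (simp add: \<eta>_def field_simps)
  finally have \<rho>: "0 < \<rho>" "\<rho> < 1" using \<theta> by simp_all
  have key: "1 / 4 \<le> c * \<rho> ^ (2 ^ k)"
    if gap: "\<And>\<xi>. \<xi> \<in> Cc \<Longrightarrow> I (\<lambda>x. (walk_mean B 0 (\<lambda>g. \<xi> (g \<otimes> x)))\<^sup>2) \<le> \<theta> * I (\<lambda>x. (\<xi> x)\<^sup>2)" for k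
  proof -
    define n where "n = nat \<lfloor>\<eta> * 2 ^ k\<rfloor>"
    define a where "a = 2 * (2 ^ k * C)"
    have n: "real n \<le> \<eta> * 2 ^ k" using \<eta> by (simp add: n_def)
    from N[rule_format, of n] obtain Y where Y: "finite Y" "Y \<subseteq> carrier G" "card Y \<le> N ^ n"
      "\<forall>x\<in>product_power S' n <#> S'. \<exists>y\<in>Y. y \<otimes> x \<in> S'"
      by (elim exE conjE)
    have inX: "g \<in> K \<union> product_power S' n" if g: "g \<in> carrier G" "\<psi> g \<le> a" for g
    proof (cases "g \<in> K")
      case False
      then have "real (word_length G S g) \<le> \<eta> / (2 * C) * \<psi> g" using K(2) g(1) by (simp add: \<psi>_def)
      also have "\<dots> \<le> \<eta> / (2 * C) * a" using g(2) \<eta> C by (intro mult_left_mono) auto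
      also have "\<dots> = \<eta> * 2 ^ k" using C by (simp add: a_def)
      finally have "word_length G S g \<le> n" unfolding n_def by (simp add: le_nat_floor)
      then show ?thesis
        using word_ball_subset_product_power[OF S _ S'G oneS' g(1)] by (auto simp: S'_def)
    qed simp
    have cov: "\<exists>y\<in>Z \<union> Y. y \<otimes> x \<in> S'" if x: "x \<in> (K \<union> product_power S' n) <#> S'" for x
    proof -
      have "x \<in> K <#> S' \<or> x \<in> product_power S' n <#> S'" using x by (auto simp: set_mult_def)
      then show ?thesis using Z(3) Y(4) VS by blast
    qed
    have en: "walk_mean B k \<psi> \<le> a / 2"
    proof -
      have "walk_mean B k \<psi> \<le> 2 ^ k * walk_mean B 0 \<psi>"
        unfolding \<psi>_def by (rule walk_mean_energy[OF Bw b])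
      also have "\<dots> \<le> 2 ^ k * C" by (rule mult_left_mono) (simp_all add: C_def)
      finally show ?thesis by (simp add: a_def)
    qed
    have "(I w)\<^sup>2 / 4 \<le> I (\<lambda>x. (walk_mean B k (\<lambda>g. w (g \<otimes> x)))\<^sup>2) * ((real (card (Z \<union> Y)))\<^sup>2 * U)"
      unfolding U_def
    proof (rule walk_return_lower_bound[OF Bw I(1)])
      show "w \<in> Cc" "u \<in> Cc" by (fact w(1), fact u(1))
      show "0 \<le> w x" "0 \<le> u x" if "x \<in> carrier G" for x using w(2) u(2) that by auto
      show "w x = 0" if "x \<in> carrier G - S'" for x using that by (intro K0(2)) (auto simp: S'_def)
      show "u x = 1" if "x \<in> S'" for x using u(3) that by simp
      show "finite (Z \<union> Y)" "Z \<union> Y \<subseteq> carrier G" using Z(1,2) Y(1,2) by simp_all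
      show "\<exists>y\<in>Z \<union> Y. y \<otimes> x \<in> S'" if "x \<in> (K \<union> product_power S' n) <#> S'" for x
        by (rule cov[OF that])
      show "\<psi> (inv g) = \<psi> g" if "g \<in> carrier G" for g by (rule \<psi>inv[OF that])
      show "0 \<le> \<psi> g" for g by (simp add: \<psi>_def)
      show "g \<in> K \<union> product_power S' n" if "g \<in> carrier G" "\<psi> g \<le> a" for g by (rule inX[OF that])
      show "0 < a" using C by (simp add: a_def)
      show "walk_mean B k \<psi> \<le> a / 2" by (rule en)
    qed
    also have "\<dots> \<le> (\<theta> ^ (2 ^ k) * W) * ((real (card (Z \<union> Y)))\<^sup>2 * U)"
      unfolding W_def using \<theta> UW
      by (intro mult_right_mono walk_contraction[OF Bw I(1) gap _ w(1)]) auto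
    also have "\<dots> \<le> (\<theta> ^ (2 ^ k) * W) * (((real (card Z) + 1)\<^sup>2 * (N' powr (2 * \<eta>)) ^ (2 ^ k)) * U)"
    proof (intro mult_left_mono mult_right_mono)
      have "real (card (Z \<union> Y)) \<le> real (card Z) + real (card Y)"
        using card_Un_le[of Z Y] by linarith
      also have "real (card Y) \<le> N' ^ n"
      proof -
        have "real (card Y) \<le> real N ^ n" using Y(3) by (metis of_nat_le_iff of_nat_power)
        also have "\<dots> \<le> N' ^ n" by (intro power_mono) (auto simp: N'_def)
        finally show ?thesis .
      qed
      also have "real (card Z) + N' ^ n \<le> (real (card Z) + 1) * N' ^ n"
      proof -
        have "1 \<le> N' ^ n" by (intro one_le_power) (simp add: N'_def)
        then have "real (card Z) * 1 \<le> real (card Z) * N' ^ n" by (intro mult_left_mono) auto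
        then show ?thesis by (simp add: distrib_right)
      qed
      finally have "real (card (Z \<union> Y)) \<le> (real (card Z) + 1) * N' ^ n" by simp
      then have "(real (card (Z \<union> Y)))\<^sup>2 \<le> ((real (card Z) + 1) * N' ^ n)\<^sup>2"
        by (intro power_mono) auto
      also have "\<dots> = (real (card Z) + 1)\<^sup>2 * (N' ^ n)\<^sup>2" by (simp add: power_mult_distrib)
      also have "(N' ^ n)\<^sup>2 \<le> (N' powr (2 * \<eta>)) ^ (2 ^ k)"
      proof -
        have "N' ^ n = N' powr real n" by (simp add: powr_realpow N'_def)
        also have "\<dots> \<le> N' powr (\<eta> * 2 ^ k)" using n by (intro powr_mono) (auto simp: N'_def)
        finally have "(N' ^ n)\<^sup>2 \<le> (N' powr (\<eta> * 2 ^ k))\<^sup>2"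
          by (intro power_mono) (auto simp: N'_def)
        also have "\<dots> = (N' powr (2 * \<eta>)) ^ (2 ^ k)"
          by (simp add: powr_def N'_def exp_of_nat_mult[symmetric] algebra_simps)
        finally show ?thesis .
      qed
      finally show "(real (card (Z \<union> Y)))\<^sup>2 \<le> (real (card Z) + 1)\<^sup>2 * (N' powr (2 * \<eta>)) ^ 2 ^ k"
        by (simp add: mult_left_mono)
    qed (use UW \<theta> in auto)
    also have "\<dots> = c * \<rho> ^ (2 ^ k)" by (simp add: c_def \<rho>_def power_mult_distrib)
    finally show ?thesis using I(2) by simp
  qed
  have "\<exists>\<xi>. \<xi> \<in> Cc \<and> 0 < I (\<lambda>x. (\<xi> x)\<^sup>2) \<and>
    (\<forall>g\<in>F. I (\<lambda>x. (\<xi> (g \<otimes> x) - \<xi> x)\<^sup>2) \<le> \<epsilon> * I (\<lambda>x. (\<xi> x)\<^sup>2))"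
  proof (rule ccontr)
    assume no: "\<not> ?thesis"
    have gap: "I (\<lambda>x. (walk_mean B 0 (\<lambda>g. \<xi> (g \<otimes> x)))\<^sup>2) \<le> \<theta> * I (\<lambda>x. (\<xi> x)\<^sup>2)" if \<xi>: "\<xi> \<in> Cc" for \<xi>
    proof (cases "0 < I (\<lambda>x. (\<xi> x)\<^sup>2)")
      case True
      with no \<xi> obtain g where g: "g \<in> F" "\<epsilon> * I (\<lambda>x. (\<xi> x)\<^sup>2) < I (\<lambda>x. (\<xi> (g \<otimes> x) - \<xi> x)\<^sup>2)"
        by (auto simp: not_le)
      show ?thesis
        unfolding \<theta>_def using g
        by (intro walk_step_contraction[OF Bw I(1) _ B(5) \<xi>, of g]) (auto simp: B_def)
    next
      case False
      have "0 \<le> I (\<lambda>x. (\<xi> x)\<^sup>2)" by (intro haar_nonneg[OF I(1)] Cc_power2 \<xi>) simp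
      with False have zero: "I (\<lambda>x. (\<xi> x)\<^sup>2) = 0" by simp
      have "0 \<le> I (\<lambda>x. (\<xi> (\<one> \<otimes> x) - \<xi> x)\<^sup>2)"
        by (intro haar_nonneg[OF I(1)] Cc_power2 Cc_diff Cc_translate \<xi>) auto
      then show ?thesis
        unfolding \<theta>_def
        by (intro walk_step_contraction[OF Bw I(1) B(5) B(5) \<xi>]) (simp add: zero)
    qed
    obtain m where m: "\<rho> ^ m < 1 / (4 * (c + 1))"
      using real_arch_pow_inv[of "1 / (4 * (c + 1))" \<rho>] \<rho> c0 by auto
    have "\<rho> ^ (2 ^ m) \<le> \<rho> ^ m" using \<rho> by (intro power_decreasing) (auto simp: less_imp_le)
    then have "1 / 4 \<le> c * \<rho> ^ m"
      using key[OF gap, of m] c0 by (meson mult_left_mono order_trans)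
    also have "\<dots> \<le> c * (1 / (4 * (c + 1)))" using m c0 by (intro mult_left_mono) auto
    also have "\<dots> < 1 / 4" using c0 by (simp add: field_simps)
    finally show False by simp
  qed
  then show ?thesis using I(1) by blast
qed

definition mean_on_bounded_continuous :: "(('a \<Rightarrow> real) \<Rightarrow> real) \<Rightarrow> bool" where
  "mean_on_bounded_continuous m \<longleftrightarrow>
     (\<forall>f\<in>bounded_continuous_functions T. \<forall>h\<in>bounded_continuous_functions T.
        m (\<lambda>x. f x + h x) = m f + m h) \<and>
     (\<forall>f\<in>bounded_continuous_functions T. \<forall>c. m (\<lambda>x. c * f x) = c * m f) \<and>
     (\<forall>f\<in>bounded_continuous_functions T. (\<forall>x\<in>carrier G. 0 \<le> f x) \<longrightarrow> 0 \<le> m f) \<and>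
     m (\<lambda>x. 1) = 1"

text \<open>
  The mean with density \<open>\<xi>\<^sup>2\<close>. Translating the argument of \<open>f\<close> moves the density to
  \<open>\<xi>'\<^sup>2\<close>, and \<open>\<xi>'\<^sup>2 - \<xi>\<^sup>2 = (\<xi>' - \<xi>) (\<xi>' + \<xi>)\<close> is small by the Cauchy-Schwarz inequality.
\<close>

lemma almost_invariant_mean:
  assumes I: "haar_functional I" and \<xi>: "\<xi> \<in> Cc" "0 < I (\<lambda>x. (\<xi> x)\<^sup>2)"
    and \<delta>: "0 < \<delta>"
    and inv\<xi>: "\<And>g. g \<in> F \<Longrightarrow> I (\<lambda>x. (\<xi> (inv g \<otimes> x) - \<xi> x)\<^sup>2) \<le> (\<delta> / 2)\<^sup>2 * I (\<lambda>x. (\<xi> x)\<^sup>2)"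
    and F: "F \<subseteq> carrier G"
  shows "\<exists>m. mean_on_bounded_continuous m \<and>
    (\<forall>g\<in>F. \<forall>f\<in>bounded_continuous_functions T. \<forall>M. (\<forall>x\<in>carrier G. \<bar>f x\<bar> \<le> M) \<longrightarrow>
       \<bar>m (\<lambda>x. f (g \<otimes> x)) - m f\<bar> \<le> M * \<delta>)"
proof -
  define r where "r = I (\<lambda>x. (\<xi> x)\<^sup>2)"
  have r: "0 < r" using \<xi>(2) by (simp add: r_def)
  define m where "m f = I (\<lambda>x. f x * (\<xi> x)\<^sup>2) / r" for f
  have cont: "continuous_map T euclideanreal f" if "f \<in> bounded_continuous_functions T" for f
    using that by (simp add: bounded_continuous_functions_def)
  have fC: "(\<lambda>x. f x * (\<xi> x)\<^sup>2) \<in> Cc" if "f \<in> bounded_continuous_functions T" for f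
    by (intro Cc_mult_continuous Cc_power2 \<xi> cont that)
  have "mean_on_bounded_continuous m"
    unfolding mean_on_bounded_continuous_def
  proof (intro conjI ballI allI impI)
    fix f h assume f: "f \<in> bounded_continuous_functions T" and h: "h \<in> bounded_continuous_functions T"
    show "m (\<lambda>x. f x + h x) = m f + m h"
      using haar_add[OF I fC[OF f] fC[OF h]] by (simp add: m_def distrib_right add_divide_distrib)
  next
    fix f and c :: real assume f: "f \<in> bounded_continuous_functions T"
    show "m (\<lambda>x. c * f x) = c * m f"
      using haar_scale[OF I fC[OF f], of c] by (simp add: m_def mult.assoc)
  next
    fix f assume f: "f \<in> bounded_continuous_functions T" "\<forall>x\<in>carrier G. 0 \<le> f x"
    show "0 \<le> m f"
      unfolding m_def using r f(2) by (intro divide_nonneg_pos haar_nonneg[OF I fC[OF f(1)]]) auto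
  next
    show "m (\<lambda>x. 1) = 1" using r by (simp add: m_def r_def)
  qed
  moreover have "\<bar>m (\<lambda>x. f (g \<otimes> x)) - m f\<bar> \<le> M * \<delta>"
    if g: "g \<in> F" and f: "f \<in> bounded_continuous_functions T" and M: "\<forall>x\<in>carrier G. \<bar>f x\<bar> \<le> M" for g f M
  proof -
    have gG: "g \<in> carrier G" using g F by auto
    have M0: "0 \<le> M" using M by (metis abs_ge_zero one_closed order_trans)
    define \<xi>' where "\<xi>' = (\<lambda>x. \<xi> (inv g \<otimes> x))"
    have \<xi>': "\<xi>' \<in> Cc" unfolding \<xi>'_def using gG by (intro Cc_translate \<xi>) simp
    have r': "I (\<lambda>x. (\<xi>' x)\<^sup>2) = r"
      unfolding \<xi>'_def r_def using haar_translate[OF I Cc_power2[OF \<xi>(1)], of "inv g"] gG by simp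
    have cg: "continuous_map T euclideanreal (\<lambda>x. f (g \<otimes> x))"
      using continuous_map_compose[OF left_translation_continuous[OF gG] cont[OF f]] by (simp add: o_def)
    have f1: "(\<lambda>x. f (g \<otimes> x) * (\<xi> x)\<^sup>2) \<in> Cc" by (intro Cc_mult_continuous Cc_power2 \<xi> cg)
    have f2: "(\<lambda>x. f x * (\<xi>' x)\<^sup>2) \<in> Cc" by (intro Cc_mult_continuous Cc_power2 \<xi>' cont f)
    have ig: "inv g \<in> carrier G" using gG by simp
    have "I (\<lambda>x. f (g \<otimes> x) * (\<xi> x)\<^sup>2) = I (\<lambda>x. f (g \<otimes> (inv g \<otimes> x)) * (\<xi> (inv g \<otimes> x))\<^sup>2)"
      using haar_translate[OF I f1 ig] by simp
    also have "\<dots> = I (\<lambda>x. f x * (\<xi>' x)\<^sup>2)"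
      by (rule haar_cong[OF I Cc_translate[OF f1 ig] f2]) (use gG in \<open>simp add: \<xi>'_def m_assoc[symmetric]\<close>)
    finally have tr: "I (\<lambda>x. f (g \<otimes> x) * (\<xi> x)\<^sup>2) = I (\<lambda>x. f x * (\<xi>' x)\<^sup>2)" .
    define p q where "p = (\<lambda>x. \<xi>' x - \<xi> x)" and "q = (\<lambda>x. f x * (\<xi>' x + \<xi> x))"
    have pC: "p \<in> Cc" unfolding p_def by (intro Cc_diff \<xi>' \<xi>)
    have qC: "q \<in> Cc" unfolding q_def by (intro Cc_mult_continuous Cc_add \<xi>' \<xi> cont f)
    have "I (\<lambda>x. f x * (\<xi>' x)\<^sup>2) - I (\<lambda>x. f x * (\<xi> x)\<^sup>2) = I (\<lambda>x. f x * (\<xi>' x)\<^sup>2 - f x * (\<xi> x)\<^sup>2)"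
      by (rule haar_diff[OF I f2 fC[OF f], symmetric])
    also have "(\<lambda>x. f x * (\<xi>' x)\<^sup>2 - f x * (\<xi> x)\<^sup>2) = (\<lambda>x. p x * q x)"
      by (rule ext) (simp add: p_def q_def power2_eq_square algebra_simps)
    finally have diff: "m (\<lambda>x. f (g \<otimes> x)) - m f = I (\<lambda>x. p x * q x) / r"
      by (simp only: m_def tr diff_divide_distrib[symmetric])
    have q2: "I (\<lambda>x. (q x)\<^sup>2) \<le> 4 * M\<^sup>2 * r"
    proof -
      have "I (\<lambda>x. (q x)\<^sup>2) \<le> I (\<lambda>x. (2 * M\<^sup>2) * ((\<xi>' x)\<^sup>2 + (\<xi> x)\<^sup>2))"
      proof (intro haar_mono[OF I] Cc_power2 qC Cc_scale Cc_add \<xi> \<xi>')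
        fix x assume x: "x \<in> carrier G"
        have "(f x)\<^sup>2 \<le> M\<^sup>2" using M x by (intro abs_le_square_iff[THEN iffD1]) (simp add: M0)
        moreover have "(\<xi>' x + \<xi> x)\<^sup>2 \<le> 2 * ((\<xi>' x)\<^sup>2 + (\<xi> x)\<^sup>2)"
          using sum_squares_bound[of "\<xi>' x" "\<xi> x"] by (simp add: power2_sum)
        ultimately have le: "(f x)\<^sup>2 * (\<xi>' x + \<xi> x)\<^sup>2 \<le> M\<^sup>2 * (2 * ((\<xi>' x)\<^sup>2 + (\<xi> x)\<^sup>2))"
          by (intro mult_mono) auto
        have "(q x)\<^sup>2 = (f x)\<^sup>2 * (\<xi>' x + \<xi> x)\<^sup>2"
          by (simp add: q_def power_mult_distrib)
        also note le
        also have "M\<^sup>2 * (2 * ((\<xi>' x)\<^sup>2 + (\<xi> x)\<^sup>2)) = (2 * M\<^sup>2) * ((\<xi>' x)\<^sup>2 + (\<xi> x)\<^sup>2)"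
          by simp
        finally show "(q x)\<^sup>2 \<le> (2 * M\<^sup>2) * ((\<xi>' x)\<^sup>2 + (\<xi> x)\<^sup>2)" .
      qed
      also have "\<dots> = (2 * M\<^sup>2) * I (\<lambda>x. (\<xi>' x)\<^sup>2 + (\<xi> x)\<^sup>2)"
        by (intro haar_scale[OF I] Cc_add Cc_power2 \<xi> \<xi>')
      also have "I (\<lambda>x. (\<xi>' x)\<^sup>2 + (\<xi> x)\<^sup>2) = r + r"
        using haar_add[OF I Cc_power2[OF \<xi>'] Cc_power2[OF \<xi>(1)]] r' by (simp add: r_def)
      finally show ?thesis by simp
    qed
    have p2: "I (\<lambda>x. (p x)\<^sup>2) \<le> (\<delta> / 2)\<^sup>2 * r"
      unfolding p_def \<xi>'_def r_def by (rule inv\<xi>[OF g])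
    have "(I (\<lambda>x. p x * q x))\<^sup>2 \<le> I (\<lambda>x. (p x)\<^sup>2) * I (\<lambda>x. (q x)\<^sup>2)"
      by (rule haar_Cauchy_Schwarz[OF I pC qC])
    also have "\<dots> \<le> ((\<delta> / 2)\<^sup>2 * r) * (4 * M\<^sup>2 * r)"
      using r by (intro mult_mono p2 q2 haar_nonneg[OF I] Cc_power2 qC) auto
    also have "\<dots> = (M * \<delta> * r)\<^sup>2" by (simp add: power2_eq_square)
    finally have "\<bar>I (\<lambda>x. p x * q x)\<bar> \<le> \<bar>M * \<delta> * r\<bar>" by (simp add: abs_le_square_iff)
    then have "\<bar>I (\<lambda>x. p x * q x)\<bar> \<le> M * \<delta> * r" using M0 \<delta> r by simp
    then show ?thesis unfolding diff using r by (simp add: field_simps)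
  qed
  ultimately show ?thesis by blast
qed

text \<open>
  A limit of the given means along an ultrafilter on pairs of a finite set \<open>F\<close>, increasing to the
  carrier, and a number \<open>n\<close> with tolerance \<open>1 / (n + 1)\<close>.
\<close>

lemma amenable_if_almost_invariant_means:
  assumes "\<And>F \<delta>. finite F \<Longrightarrow> F \<subseteq> carrier G \<Longrightarrow> 0 < \<delta> \<Longrightarrow> \<delta> \<le> 1 \<Longrightarrow>
    \<exists>m. mean_on_bounded_continuous m \<and>
      (\<forall>g\<in>F. \<forall>f\<in>bounded_continuous_functions T. \<forall>M. (\<forall>x\<in>carrier G. \<bar>f x\<bar> \<le> M) \<longrightarrow>
         \<bar>m (\<lambda>x. f (g \<otimes> x)) - m f\<bar> \<le> M * \<delta>)"
  shows "amenable G T"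
proof -
  let ?CB = "bounded_continuous_functions T"
  have "\<forall>p. \<exists>m. finite (fst p) \<and> fst p \<subseteq> carrier G \<longrightarrow> mean_on_bounded_continuous m \<and>
      (\<forall>g\<in>fst p. \<forall>f\<in>?CB. \<forall>M. (\<forall>x\<in>carrier G. \<bar>f x\<bar> \<le> M) \<longrightarrow>
         \<bar>m (\<lambda>x. f (g \<otimes> x)) - m f\<bar> \<le> M * (1 / real (Suc (snd p))))"
  proof
    fix p :: "'a set \<times> nat"
    show "\<exists>m. finite (fst p) \<and> fst p \<subseteq> carrier G \<longrightarrow> mean_on_bounded_continuous m \<and>
      (\<forall>g\<in>fst p. \<forall>f\<in>?CB. \<forall>M. (\<forall>x\<in>carrier G. \<bar>f x\<bar> \<le> M) \<longrightarrow>
         \<bar>m (\<lambda>x. f (g \<otimes> x)) - m f\<bar> \<le> M * (1 / real (Suc (snd p))))"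
      using assms[of "fst p" "1 / real (Suc (snd p))"] by auto
  qed
  then obtain \<mu> where \<mu>': "\<forall>p. finite (fst p) \<and> fst p \<subseteq> carrier G \<longrightarrow> mean_on_bounded_continuous (\<mu> p) \<and>
      (\<forall>g\<in>fst p. \<forall>f\<in>?CB. \<forall>M. (\<forall>x\<in>carrier G. \<bar>f x\<bar> \<le> M) \<longrightarrow>
         \<bar>\<mu> p (\<lambda>x. f (g \<otimes> x)) - \<mu> p f\<bar> \<le> M * (1 / real (Suc (snd p))))"
    by (rule choice[THEN exE])
  have \<mu>mean: "mean_on_bounded_continuous (\<mu> p)" if "finite (fst p)" "fst p \<subseteq> carrier G" for p
    using \<mu>' that by blast
  have \<mu>inv: "\<bar>\<mu> p (\<lambda>x. f (g \<otimes> x)) - \<mu> p f\<bar> \<le> M * (1 / real (Suc (snd p)))"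
    if "finite (fst p)" "fst p \<subseteq> carrier G" "g \<in> fst p" "f \<in> ?CB" "\<forall>x\<in>carrier G. \<bar>f x\<bar> \<le> M" for p g f M
    using \<mu>' that by blast
  define \<F> where "\<F> = finite_subsets_at_top (carrier G) \<times>\<^sub>F sequentially"
  have "\<F> \<noteq> bot" by (simp add: \<F>_def prod_filter_eq_bot)
  then obtain U where U: "U \<le> \<F>" "ultrafilter U" using finer_ultrafilter_exists by blast
  have Unb: "U \<noteq> bot" using U(2) by (simp add: ultrafilter_def)
  have evF: "eventually (\<lambda>p. finite (fst p) \<and> fst p \<subseteq> carrier G \<and> g \<in> fst p) U" if "g \<in> carrier G" for g
  proof -
    have "eventually (\<lambda>F. finite F \<and> F \<subseteq> carrier G \<and> g \<in> F) (finite_subsets_at_top (carrier G))"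
      unfolding eventually_finite_subsets_at_top using that by (intro exI[of _ "{g}"]) auto
    then have "eventually (\<lambda>p. finite (fst p) \<and> fst p \<subseteq> carrier G \<and> g \<in> fst p) \<F>"
      unfolding \<F>_def by (rule eventually_compose_filterlim[OF _ filterlim_fst])
    then show ?thesis using U(1) by (simp add: filter_leD)
  qed
  have evM: "eventually (\<lambda>p. mean_on_bounded_continuous (\<mu> p)) U"
    using evF[OF one_closed] by eventually_elim (rule \<mu>mean; simp)
  have snd: "LIM p U. snd p :> sequentially"
  proof -
    have "filterlim snd sequentially \<F>" unfolding \<F>_def by (rule filterlim_snd)
    then show ?thesis by (rule filterlim_mono[OF _ order_refl U(1)])
  qed
  have bound: "\<exists>M. \<forall>x\<in>carrier G. \<bar>f x\<bar> \<le> M" if "f \<in> ?CB" for f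
    using that by (auto simp: bounded_continuous_functions_def bounded_iff topspace_eq)
  have CB_add: "(\<lambda>x. f x + h x) \<in> ?CB" if "f \<in> ?CB" "h \<in> ?CB" for f h
    using that bounded_plus_comp[of f "topspace T" h]
    by (simp add: bounded_continuous_functions_def continuous_map_add)
  have CB_scale: "(\<lambda>x. c * f x) \<in> ?CB" if "f \<in> ?CB" for f c
    using that bounded_scaleR_comp[of f "topspace T" c]
    by (simp add: bounded_continuous_functions_def continuous_map_real_mult_left)
  have CB_const: "(\<lambda>x. c) \<in> ?CB" for c
    by (auto simp: bounded_continuous_functions_def bounded_iff)
  have CB_translate: "(\<lambda>x. f (g \<otimes> x)) \<in> ?CB" if "f \<in> ?CB" "g \<in> carrier G" for f g
  proof -
    have "continuous_map T euclideanreal (\<lambda>x. f (g \<otimes> x))"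
      using continuous_map_compose[OF left_translation_continuous[OF that(2)], of euclideanreal f] that(1)
      by (simp add: bounded_continuous_functions_def o_def)
    moreover have "(\<lambda>x. f (g \<otimes> x)) ` topspace T \<subseteq> f ` topspace T"
      using that(2) by (auto simp: topspace_eq)
    ultimately show ?thesis
      using that(1) bounded_subset by (auto simp: bounded_continuous_functions_def)
  qed
  define m where "m f = Lim U (\<lambda>p. \<mu> p f)" for f
  have lim: "((\<lambda>p. \<mu> p f) \<longlongrightarrow> m f) U" if f: "f \<in> ?CB" for f
  proof -
    obtain M where M: "\<forall>x\<in>carrier G. \<bar>f x\<bar> \<le> M" using bound[OF f] by blast
    show ?thesis
      unfolding m_def
    proof (rule ultrafilter_bounded_convergent[OF U(2)])
      show "eventually (\<lambda>p. - M \<le> \<mu> p f \<and> \<mu> p f \<le> M) U"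
        using evM
      proof eventually_elim
        case (elim p)
        note mean = elim[unfolded mean_on_bounded_continuous_def]
        have add: "\<mu> p (\<lambda>x. f x + h x) = \<mu> p f + \<mu> p h" if "f \<in> ?CB" "h \<in> ?CB" for f h
          using mean that by blast
        have scale: "\<mu> p (\<lambda>x. c * f x) = c * \<mu> p f" if "f \<in> ?CB" for f c using mean that by blast
        have pos: "0 \<le> \<mu> p f" if "f \<in> ?CB" "\<forall>x\<in>carrier G. 0 \<le> f x" for f using mean that by blast
        have const: "\<mu> p (\<lambda>x. M) = M" using scale[OF CB_const, of M 1] mean by simp
        have neg: "\<mu> p (\<lambda>x. - 1 * f x) = - \<mu> p f" using scale[OF f, of "- 1"] by simp
        have "0 \<le> \<mu> p (\<lambda>x. M + f x)"
          using M by (intro pos CB_add CB_const f) (force simp: abs_le_iff)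
        moreover have "0 \<le> \<mu> p (\<lambda>x. M + - 1 * f x)"
          using M by (intro pos CB_add CB_const CB_scale f) (force simp: abs_le_iff)
        ultimately show ?case
          using add[OF CB_const f, of M] add[OF CB_const CB_scale[OF f, of "- 1"], of M] const neg by simp
      qed
    qed
  qed
  have "left_invariant_mean G T m"
    unfolding left_invariant_mean_def
  proof (intro conjI ballI allI impI)
    fix f h assume f: "f \<in> ?CB" and h: "h \<in> ?CB"
    have "eventually (\<lambda>p. \<mu> p (\<lambda>x. f x + h x) = \<mu> p f + \<mu> p h) U"
      using evM by eventually_elim (use f h in \<open>simp add: mean_on_bounded_continuous_def\<close>)
    then have "((\<lambda>p. \<mu> p (\<lambda>x. f x + h x)) \<longlongrightarrow> m f + m h) U"
      using tendsto_add[OF lim[OF f] lim[OF h]] by (simp add: tendsto_cong)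
    then show "m (\<lambda>x. f x + h x) = m f + m h"
      using lim[OF CB_add[OF f h]] Unb tendsto_unique by blast
  next
    fix f and c :: real assume f: "f \<in> ?CB"
    have "eventually (\<lambda>p. \<mu> p (\<lambda>x. c * f x) = c * \<mu> p f) U"
      using evM by eventually_elim (use f in \<open>simp add: mean_on_bounded_continuous_def\<close>)
    then have "((\<lambda>p. \<mu> p (\<lambda>x. c * f x)) \<longlongrightarrow> c * m f) U"
      using tendsto_mult_left[OF lim[OF f], of c] by (simp add: tendsto_cong)
    then show "m (\<lambda>x. c * f x) = c * m f"
      using lim[OF CB_scale[OF f]] Unb tendsto_unique by blast
  next
    fix f assume f: "f \<in> ?CB" "\<forall>x\<in>carrier G. 0 \<le> f x"
    have "eventually (\<lambda>p. 0 \<le> \<mu> p f) U"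
      using evM by eventually_elim (use f in \<open>simp add: mean_on_bounded_continuous_def\<close>)
    then show "0 \<le> m f" by (rule tendsto_lowerbound[OF lim[OF f(1)] _ Unb])
  next
    have "eventually (\<lambda>p. \<mu> p (\<lambda>x. 1) = 1) U"
      using evM by eventually_elim (simp add: mean_on_bounded_continuous_def)
    then have "((\<lambda>p. \<mu> p (\<lambda>x. 1)) \<longlongrightarrow> 1) U" by (rule tendsto_eventually)
    then show "m (\<lambda>x. 1) = 1" using lim[OF CB_const] Unb tendsto_unique by blast
  next
    fix f g assume f: "f \<in> ?CB" and g: "g \<in> carrier G"
    obtain M where M: "\<forall>x\<in>carrier G. \<bar>f x\<bar> \<le> M" using bound[OF f] by blast
    have "((\<lambda>p. M * (1 / real (Suc (snd p)))) \<longlongrightarrow> M * 0) U"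
      by (rule tendsto_mult_left[OF filterlim_compose[OF lim_1_over_n[THEN LIMSEQ_Suc] snd]])
    then have small: "((\<lambda>p. M * (1 / real (Suc (snd p)))) \<longlongrightarrow> 0) U" by simp
    have "eventually (\<lambda>p. norm (\<mu> p (\<lambda>x. f (g \<otimes> x)) - \<mu> p f) \<le> M * (1 / real (Suc (snd p)))) U"
      using evF[OF g]
    proof eventually_elim
      case (elim p)
      then show ?case using \<mu>inv[of p g f M] f M by simp
    qed
    from Lim_null_comparison[OF this small]
    have "((\<lambda>p. \<mu> p (\<lambda>x. f (g \<otimes> x)) - \<mu> p f) \<longlongrightarrow> 0) U" .
    moreover have "((\<lambda>p. \<mu> p (\<lambda>x. f (g \<otimes> x)) - \<mu> p f) \<longlongrightarrow> m (\<lambda>x. f (g \<otimes> x)) - m f) U"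
      by (intro tendsto_diff lim CB_translate f g)
    ultimately have "m (\<lambda>x. f (g \<otimes> x)) - m f = 0" using Unb tendsto_unique by blast
    then show "m (\<lambda>x. f (g \<otimes> x)) = m f" by simp
  qed
  then show ?thesis by (auto simp: amenable_def)
qed

section \<open>From cocycles to amenability\<close>

lemma amenable_if_cocycle_norm_grows:
  fixes b :: "'a \<Rightarrow> 'v::real_inner"
  assumes S: "compact_symmetric_generating_set G T S"
    and b: "\<And>g h. g \<in> carrier G \<Longrightarrow> h \<in> carrier G \<Longrightarrow> norm (b (g \<otimes> h)) = norm (b h - b (inv g))"
    and growth: "grows_faster T (\<lambda>g. norm (b g)) (\<lambda>g. sqrt (real (word_length G S g)))"
  shows "amenable G T"
proof (rule amenable_if_almost_invariant_means)
  fix F \<delta> assume F: "finite F" "F \<subseteq> carrier G" and \<delta>: "(0::real) < \<delta>" "\<delta> \<le> 1"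
  have growth': "\<exists>K. compactin T K \<and>
      (\<forall>g\<in>carrier G - K. real (word_length G S g) \<le> \<eta> * (norm (b g))\<^sup>2)" if \<eta>: "0 < \<eta>" for \<eta>
  proof -
    have "0 < sqrt \<eta>" using \<eta> by simp
    with growth obtain K where K: "compactin T K"
        "\<forall>g\<in>topspace T - K. sqrt (real (word_length G S g)) \<le> sqrt \<eta> * norm (b g)"
      unfolding grows_faster_def by blast
    have "real (word_length G S g) \<le> \<eta> * (norm (b g))\<^sup>2" if "g \<in> carrier G - K" for g
    proof -
      have "(sqrt (real (word_length G S g)))\<^sup>2 \<le> (sqrt \<eta> * norm (b g))\<^sup>2"
        using K(2) that by (intro power_mono) (auto simp: topspace_eq)
      then show ?thesis using \<eta> by (simp add: power_mult_distrib)
    qed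
    then show ?thesis using K(1) by blast
  qed
  have F': "finite ((\<lambda>g. inv g) ` F)" "(\<lambda>g. inv g) ` F \<subseteq> carrier G" using F by auto
  have \<delta>2: "0 < (\<delta> / 2)\<^sup>2" "(\<delta> / 2)\<^sup>2 \<le> 1" using \<delta> by (auto intro: power_le_one)
  obtain I \<xi> where I\<xi>: "haar_functional I" "\<xi> \<in> Cc" "0 < I (\<lambda>x. (\<xi> x)\<^sup>2)"
      "\<forall>g\<in>(\<lambda>g. inv g) ` F. I (\<lambda>x. (\<xi> (g \<otimes> x) - \<xi> x)\<^sup>2) \<le> (\<delta> / 2)\<^sup>2 * I (\<lambda>x. (\<xi> x)\<^sup>2)"
    using almost_invariant_vectors[OF S b growth' F' \<delta>2] by blast
  show "\<exists>m. mean_on_bounded_continuous m \<and>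
      (\<forall>g\<in>F. \<forall>f\<in>bounded_continuous_functions T. \<forall>M. (\<forall>x\<in>carrier G. \<bar>f x\<bar> \<le> M) \<longrightarrow>
         \<bar>m (\<lambda>x. f (g \<otimes> x)) - m f\<bar> \<le> M * \<delta>)"
    using I\<xi>(4) by (intro almost_invariant_mean[OF I\<xi>(1-3) \<delta>(1) _ F(2)]) auto
qed

lemma norm_cocycle_mult:
  fixes b :: "'a \<Rightarrow> 'v::real_normed_vector"
  assumes \<pi>: "continuous_representation G T \<pi>" "\<And>g v. g \<in> carrier G \<Longrightarrow> norm (\<pi> g v) = norm v"
    and b: "cocycle G T \<pi> b" and gh: "g \<in> carrier G" "h \<in> carrier G"
  shows "norm (b (g \<otimes> h)) = norm (b h - b (inv g))"
proof -
  have lin: "linear (\<pi> g)" and one: "\<pi> \<one> = id" using \<pi>(1) gh by (auto simp: continuous_representation_def)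
  have coc: "b (x \<otimes> y) = \<pi> x (b y) + b x" if "x \<in> carrier G" "y \<in> carrier G" for x y
    using b that by (simp add: cocycle_def)
  have "b \<one> = 0" using coc[of \<one> \<one>] one by simp
  then have "b g = - \<pi> g (b (inv g))" using coc[of g "inv g"] gh by (simp add: eq_neg_iff_add_eq_0 add.commute)
  then have "b (g \<otimes> h) = \<pi> g (b h - b (inv g))" using coc[OF gh] by (simp add: linear_diff[OF lin])
  then show ?thesis using \<pi>(2) gh by simp
qed

text \<open>
  Outside a large word ball \<open>\<surd>|g|\<close> is at most a small multiple of \<open>|g|\<close>, and word balls are
  contained in compact sets.
\<close>

lemma linear_growth_imp_grows_faster:
  assumes S: "compact_symmetric_generating_set G T S"
    and L: "linear_growth G T S L"
  shows "grows_faster T L (\<lambda>g. sqrt (real (word_length G S g)))"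
  unfolding grows_faster_def
proof (intro allI impI)
  fix \<epsilon> :: real assume \<epsilon>: "0 < \<epsilon>"
  obtain M K where M: "0 < M" and K: "compactin T K"
    "\<forall>g\<in>carrier G - K. real (word_length G S g) \<le> M * L g"
    using L unfolding linear_growth_def by blast
  define n where "n = nat \<lceil>(M / \<epsilon>)\<^sup>2\<rceil>"
  define S' where "S' = insert \<one> S"
  have Sc: "compactin T S" using S by (simp add: compact_symmetric_generating_set_def)
  have S'c: "compactin T S'"
    using compactin_Un[of T "{\<one>}" S] Sc by (simp add: S'_def compactin_sing topspace_eq)
  have "sqrt (real (word_length G S g)) \<le> \<epsilon> * L g"
    if g: "g \<in> topspace T - (K \<union> product_power S' n)" for g
  proof -
    have gG: "g \<in> carrier G" using g by (simp add: topspace_eq)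
    define l where "l = real (word_length G S g)"
    have "\<not> word_length G S g \<le> n"
      using word_ball_subset_product_power[OF S _ compactin_carrier[OF S'c] _ gG] g by (auto simp: S'_def)
    then have "(M / \<epsilon>)\<^sup>2 \<le> l" unfolding n_def l_def by linarith
    then have "M / \<epsilon> \<le> sqrt l" by (rule real_le_rsqrt)
    then have "M \<le> \<epsilon> * sqrt l" using \<epsilon> by (simp add: field_simps)
    then have "M * sqrt l \<le> \<epsilon> * sqrt l * sqrt l" by (intro mult_right_mono) (auto simp: l_def)
    also have "\<dots> = \<epsilon> * l" by (simp add: l_def mult.assoc)
    also have "\<dots> \<le> \<epsilon> * (M * L g)" using K(2) gG g \<epsilon> by (intro mult_left_mono) (auto simp: l_def)
    finally have "M * sqrt l \<le> M * (\<epsilon> * L g)" by (simp add: mult.left_commute)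
    then show ?thesis using M by (simp add: l_def)
  qed
  then show "\<exists>K. compactin T K \<and> (\<forall>g\<in>topspace T - K. sqrt (real (word_length G S g)) \<le> \<epsilon> * L g)"
    using K(1) compactin_product_power[OF S'c, of n] by (intro exI[of _ "K \<union> product_power S' n"]) (auto simp: compactin_Un)
qed

lemma amenable_if_hilbert_length_function_grows:
  assumes S: "compact_symmetric_generating_set G T S"
    and L: "hilbert_length_function TYPE('h::{real_inner, complete_space}) TYPE('k::complex_hilbert_space) G T L"
    and growth: "grows_faster T L (\<lambda>g. sqrt (real (word_length G S g)))"
  shows "amenable G T"
proof -
  have norm_grows: "grows_faster T (\<lambda>g. norm (b g)) (\<lambda>g. sqrt (real (word_length G S g)))"
    if "\<forall>g\<in>carrier G. L g = norm (b g)" for b :: "'a \<Rightarrow> 'v::real_inner"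
    using growth that unfolding grows_faster_def by (simp add: topspace_eq)
  show ?thesis
    using L unfolding hilbert_length_function_def
  proof (elim disjE exE conjE)
    fix \<pi> :: "'a \<Rightarrow> 'h \<Rightarrow> 'h" and b
    assume \<pi>: "orthogonal_representation G T \<pi>" and b: "cocycle G T \<pi> b"
      and Lb: "\<forall>g\<in>carrier G. L g = norm (b g)"
    have cont: "continuous_representation G T \<pi>" using \<pi> by (simp add: orthogonal_representation_def)
    have iso: "norm (\<pi> g v) = norm v" if "g \<in> carrier G" for g v
      using \<pi> that by (simp add: orthogonal_representation_def orthogonal_transformation_norm)
    show ?thesis
      by (rule amenable_if_cocycle_norm_grows[OF S norm_cocycle_mult[OF cont iso b] norm_grows[OF Lb]])
  next
    fix \<pi> :: "'a \<Rightarrow> 'k \<Rightarrow> 'k" and b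
    assume \<pi>: "unitary_representation G T \<pi>" and b: "cocycle G T \<pi> b"
      and Lb: "\<forall>g\<in>carrier G. L g = norm (b g)"
    have cont: "continuous_representation G T \<pi>" using \<pi> by (simp add: unitary_representation_def)
    have iso: "norm (\<pi> g v) = norm v" if "g \<in> carrier G" for g v
      using \<pi> that by (simp add: unitary_representation_def norm_eq_sqrt_inner Re_cinner[symmetric])
    show ?thesis
      by (rule amenable_if_cocycle_norm_grows[OF S norm_cocycle_mult[OF cont iso b] norm_grows[OF Lb]])
  qed
qed

end

theorem theorem1p2:
  fixes G :: "('a, 'm) monoid_scheme"
    and T :: "'a topology"
    and S :: "'a set"
  assumes "locally_compact_group G T"
    and "compact_symmetric_generating_set G T S"
  shows "((\<exists>L. hilbert_length_function
              TYPE('h::{real_inner, complete_space}) TYPE('k::complex_hilbert_space) G T L \<and>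
            grows_faster T L (\<lambda>g. sqrt (real (word_length G S g))))
          \<longrightarrow> amenable G T) \<and>
         ((\<exists>L. hilbert_length_function TYPE('h) TYPE('k) G T L \<and> linear_growth G T S L)
          \<longrightarrow> amenable G T)"
proof -
  interpret locally_compact_group G T by fact
  have main: "amenable G T"
    if "hilbert_length_function TYPE('h) TYPE('k) G T L"
      "grows_faster T L (\<lambda>g. sqrt (real (word_length G S g)))" for L
    by (rule amenable_if_hilbert_length_function_grows[OF assms(2) that])
  show ?thesis
  proof (intro conjI impI; elim exE conjE)
    fix L assume "hilbert_length_function TYPE('h) TYPE('k) G T L"
      "grows_faster T L (\<lambda>g. sqrt (real (word_length G S g)))"
    then show "amenable G T" by (rule main)
  next
    fix L assume L: "hilbert_length_function TYPE('h) TYPE('k) G T L" "linear_growth G T S L"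
    show "amenable G T"
      by (rule main[OF L(1) linear_growth_imp_grows_faster[OF assms(2) L(2)]])
  qed
qed

end
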